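(* Fix $k\in\mathbb Z_{\ge0}$ and an irreducible fraction $t\in(0,1)$. Then, as values of regular continued fractions, (1) $F^+(k,1/t)=\dfrac{m_{k,t}}{v^+_{k,t}}$; (2) $G^+(k,t)=\dfrac{m_{k,t}}{v^-_{k,t}}$; (3) $G^+(k,1/t)=\dfrac{m_{k,t}}{u^-_{k,t}}$.
   Context: Fix $k\in\mathbb Z_{\ge0}$. Farey tree $\mathrm{F}\mathbb T$: root $\left(\frac01,\frac11,\frac10\right)$; vertex $\left(\frac ab,\frac cd,\frac ef\right)$ has left child $\left(\frac ab,\frac{a+c}{b+d},\frac cd\right)$ and right child $\left(\frac cd,\frac{c+e}{d+f},\frac ef\right)$. $\mathrm{M}\mathbb T(k)$: root $(1,k+2,1)$; vertex $(a,b,c)$ has left child $\left(a,\frac{a^2+kab+b^2}{c},b\right)$ and right child $\left(b,\frac{b^2+kbc+c^2}{a},c\right)$. Let $\theta\colon\mathrm{F}\mathbb T\to\mathrm{M}\mathbb T(k)$ be the bijection preserving root and left/right children. For irreducible $t\in(0,1)$ let $(r,t,s)$ be the vertex of $\mathrm{F}\mathbb T$ with middle entry $t$ and $(m_r,m_t,m_s)=\theta(r,t,s)$; $m_{k,t}:=m_t$; $u^-_{k,t},v^+_{k,t},v^-_{k,t}$ are the unique $x\in(0,m_t)$ with respectively $m_rx\equiv-m_s$, $m_sx\equiv m_r$, $m_sx\equiv -m_r\pmod{m_t}$. Construction for an irreducible fraction $t=a/b$ ($a,b\ge1$, possibly $t>1$): let $L_t$ be the segment from $(0,0)$ to $(b,a)$,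 oriented left to right. The pre-snake graph is the union of the closed unit lattice squares whose interiors meet $L_t$, each split by its upper-left-to-lower-right diagonal into two right triangles; edges are square sides and these diagonals. Signs: each triangle gets one sign, $-$ if it is the first triangle met by $L_t$ or if its part lying above the line through $L_t$ is a quadrilateral, else $+$; each edge meeting the interior of $L_t$ gets $k$ copies of one sign, $-$ if its midpoint lies on or above the line through $L_t$, $+$ if strictly below. Listing the signs in the order $L_t$ passes through triangles and edges and letting $a_1,\dots,a_\ell$ be the lengths of successive maximal blocks of equal signs gives $F^+(k,t)=[a_1,\dots,a_\ell]=a_1+\cfrac1{a_2+\cfrac1{\ddots+\cfrac1{a_\ell}}}$. $G^+(k,t)$ is obtained by the same procedure except that the $k$ signs on the central edge (the edge containing the midpoint $(b/2,a/2)$ of $L_t$) are $+$ instead of $-$. *)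

theory Defs
  imports "HOL-Analysis.Analysis" "HOL-Number_Theory.Cong"
begin

text \<open>
  A fraction is a pair (numerator, denominator); this accommodates 1/0.
  Vertices of the infinite binary tree are addressed by the path leading to them from the root.
\<close>

type_synonym fraction = "nat \<times> nat"

datatype direction = ToLeft | ToRight

fun farey_child :: "direction \<Rightarrow> fraction \<times> fraction \<times> fraction \<Rightarrow> fraction \<times> fraction \<times> fraction" where
  "farey_child ToLeft ((a, b), (c, d), (e, f)) = ((a, b), (a + c, b + d), (c, d))"
| "farey_child ToRight ((a, b), (c, d), (e, f)) = ((c, d), (c + e, d + f), (e, f))"

definition farey_at :: "direction list \<Rightarrow> fraction \<times> fraction \<times> fraction" where
  "farey_at w = fold farey_child w ((0, 1), (1, 1), (1, 0))"

definition farey_tree :: "(fraction \<times> fraction \<times> fraction) set" where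
  "farey_tree = range farey_at"

text \<open>The divisions below are exact on the tree, see \<open>markov_exact\<close>.\<close>

fun markov_child :: "nat \<Rightarrow> direction \<Rightarrow> int \<times> int \<times> int \<Rightarrow> int \<times> int \<times> int" where
  "markov_child k ToLeft (a, b, c) = (a, (a\<^sup>2 + int k * a * b + b\<^sup>2) div c, b)"
| "markov_child k ToRight (a, b, c) = (b, (b\<^sup>2 + int k * b * c + c\<^sup>2) div a, c)"

definition markov_at :: "nat \<Rightarrow> direction list \<Rightarrow> int \<times> int \<times> int" where
  "markov_at k w = fold (markov_child k) w (1, int k + 2, 1)"

definition theta :: "nat \<Rightarrow> fraction \<times> fraction \<times> fraction \<Rightarrow> int \<times> int \<times> int" where
  "theta k T = markov_at k (THE w. farey_at w = T)"

definition farey_vertex :: "fraction \<Rightarrow> fraction \<times> fraction \<times> fraction" where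
  "farey_vertex t = (THE T. T \<in> farey_tree \<and> fst (snd T) = t)"

definition m_left :: "nat \<Rightarrow> fraction \<Rightarrow> int" where
  "m_left k t = fst (theta k (farey_vertex t))"

definition m_mid :: "nat \<Rightarrow> fraction \<Rightarrow> int" where
  "m_mid k t = fst (snd (theta k (farey_vertex t)))"

definition m_right :: "nat \<Rightarrow> fraction \<Rightarrow> int" where
  "m_right k t = snd (snd (theta k (farey_vertex t)))"

definition u_minus :: "nat \<Rightarrow> fraction \<Rightarrow> int" where
  "u_minus k t = (THE x. 0 < x \<and> x < m_mid k t \<and>
      [m_left k t * x = - m_right k t] (mod m_mid k t))"

definition v_plus :: "nat \<Rightarrow> fraction \<Rightarrow> int" where
  "v_plus k t = (THE x. 0 < x \<and> x < m_mid k t \<and>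
      [m_right k t * x = m_left k t] (mod m_mid k t))"

definition v_minus :: "nat \<Rightarrow> fraction \<Rightarrow> int" where
  "v_minus k t = (THE x. 0 < x \<and> x < m_mid k t \<and>
      [m_right k t * x = - m_left k t] (mod m_mid k t))"


lemma markov_equation_step:
  fixes a b c k :: int
  assumes "c > 0" "a > 0" "b > 0" "k \<ge> 0"
    and eq: "a\<^sup>2 + b\<^sup>2 + c\<^sup>2 + k * (a * b + b * c + c * a) = (3 + 3 * k) * a * b * c"
  shows "c dvd a\<^sup>2 + k * a * b + b\<^sup>2"
    and "(a\<^sup>2 + k * a * b + b\<^sup>2) div c > 0"
    and "d = (a\<^sup>2 + k * a * b + b\<^sup>2) div c \<Longrightarrow>
      a\<^sup>2 + b\<^sup>2 + d\<^sup>2 + k * (a * b + b * d + d * a) = (3 + 3 * k) * a * b * d"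
proof -
  let ?e = "(3 + 3 * k) * a * b - c - k * a - k * b"
  have e: "a\<^sup>2 + k * a * b + b\<^sup>2 = c * ?e"
    using eq by (simp add: algebra_simps power2_eq_square)
  then show "c dvd a\<^sup>2 + k * a * b + b\<^sup>2" by simp
  have q: "(a\<^sup>2 + k * a * b + b\<^sup>2) div c = ?e" using e assms(1) by simp
  have "0 < a\<^sup>2 + k * a * b + b\<^sup>2"
    using assms by (intro add_pos_pos add_pos_nonneg) auto
  then show "(a\<^sup>2 + k * a * b + b\<^sup>2) div c > 0"
    using e q assms(1) by (metis zero_less_mult_pos)
  show "a\<^sup>2 + b\<^sup>2 + d\<^sup>2 + k * (a * b + b * d + d * a) = (3 + 3 * k) * a * b * d"
    if d: "d = (a\<^sup>2 + k * a * b + b\<^sup>2) div c"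
  proof -
    have "a\<^sup>2 + k * a * b + b\<^sup>2 = c * d" and "c = (3 + 3 * k) * a * b - d - k * a - k * b"
      using e q d by auto
    then show ?thesis by (simp add: algebra_simps power2_eq_square)
  qed
qed

lemma markov_invariant:
  "case markov_at k w of (a, b, c) \<Rightarrow> a > 0 \<and> b > 0 \<and> c > 0 \<and>
     a\<^sup>2 + b\<^sup>2 + c\<^sup>2 + int k * (a * b + b * c + c * a) = (3 + 3 * int k) * a * b * c"
proof (induction w rule: rev_induct)
  case Nil
  show ?case by (simp add: markov_at_def algebra_simps power2_eq_square)
next
  case (snoc x w)
  obtain a b c where w: "markov_at k w = (a, b, c)" by (cases "markov_at k w")
  have s: "markov_at k (w @ [x]) = markov_child k x (a, b, c)"
    using w by (simp add: markov_at_def)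
  have h: "a > 0" "b > 0" "c > 0"
    and eq: "a\<^sup>2 + b\<^sup>2 + c\<^sup>2 + int k * (a * b + b * c + c * a) = (3 + 3 * int k) * a * b * c"
    using snoc w by auto
  have eq': "b\<^sup>2 + c\<^sup>2 + a\<^sup>2 + int k * (b * c + c * a + a * b) = (3 + 3 * int k) * b * c * a"
    using eq by (simp add: algebra_simps)
  show ?case
  proof (cases x)
    case ToLeft
    then show ?thesis
      using s h markov_equation_step(2,3)[OF h(3,1,2) _ eq] by (simp add: algebra_simps)
  next
    case ToRight
    then show ?thesis
      using s h markov_equation_step(2,3)[OF h(1,2,3) _ eq'] by (simp add: algebra_simps)
  qed
qed

lemma markov_exact:
  assumes "markov_at k w = (a, b, c)"
  shows "c dvd a\<^sup>2 + int k * a * b + b\<^sup>2" and "a dvd b\<^sup>2 + int k * b * c + c\<^sup>2"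
proof -
  have h: "a > 0" "b > 0" "c > 0"
    and eq: "a\<^sup>2 + b\<^sup>2 + c\<^sup>2 + int k * (a * b + b * c + c * a) = (3 + 3 * int k) * a * b * c"
    using markov_invariant[of k w] assms by auto
  have eq': "b\<^sup>2 + c\<^sup>2 + a\<^sup>2 + int k * (b * c + c * a + a * b) = (3 + 3 * int k) * b * c * a"
    using eq by (simp add: algebra_simps)
  show "c dvd a\<^sup>2 + int k * a * b + b\<^sup>2" using markov_equation_step(1)[OF h(3,1,2) _ eq] by simp
  show "a dvd b\<^sup>2 + int k * b * c + c\<^sup>2" using markov_equation_step(1)[OF h _ eq'] by simp
qed


type_synonym point = "real \<times> real"

fun seg_end :: "fraction \<Rightarrow> point" where
  "seg_end (a, b) = (real b, real a)"

fun on_or_above :: "fraction \<Rightarrow> point set" where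
  "on_or_above (a, b) = {(x, y). real b * y \<ge> real a * x}"

datatype cell = Edge point point | Triangle point point point

fun region :: "cell \<Rightarrow> point set" where
  "region (Edge p q) = closed_segment p q"
| "region (Triangle p q r) = convex hull {p, q, r}"

definition unit_square :: "int \<Rightarrow> int \<Rightarrow> point set" where
  "unit_square i j = {real_of_int i .. real_of_int i + 1} \<times> {real_of_int j .. real_of_int j + 1}"

text \<open>
  Sides are listed from left to right or from bottom to top, so that a side shared by two
  neighbouring squares is the same cell.
\<close>

definition square_cells :: "int \<Rightarrow> int \<Rightarrow> cell set" where
  "square_cells i j =
    (let sw = (real_of_int i, real_of_int j); se = (real_of_int i + 1, real_of_int j);
         nw = (real_of_int i, real_of_int j + 1); ne = (real_of_int i + 1, real_of_int j + 1)
     in {Triangle sw se nw, Triangle se nw ne,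
         Edge nw se, Edge sw se, Edge nw ne, Edge sw nw, Edge se ne})"

definition pre_snake_cells :: "fraction \<Rightarrow> cell set" where
  "pre_snake_cells t = \<Union> {square_cells i j | i j.
      interior (unit_square i j) \<inter> closed_segment (0, 0) (seg_end t) \<noteq> {}}"

fun met_by_segment :: "fraction \<Rightarrow> cell \<Rightarrow> bool" where
  "met_by_segment t (Edge p q) \<longleftrightarrow>
     closed_segment p q \<inter> open_segment (0, 0) (seg_end t) \<noteq> {}"
| "met_by_segment t (Triangle p q r) \<longleftrightarrow>
     interior (convex hull {p, q, r}) \<inter> closed_segment (0, 0) (seg_end t) \<noteq> {}"

text \<open>
  The segment runs from left to right, so its points are ordered by their abscissa; relative
  interiors of distinct cells are disjoint, so no ties arise.
\<close>

definition passed_before :: "fraction \<Rightarrow> cell \<Rightarrow> cell \<Rightarrow> bool" where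
  "passed_before t c d \<longleftrightarrow>
    (\<forall>p \<in> rel_interior (region c) \<inter> closed_segment (0, 0) (seg_end t).
     \<forall>q \<in> rel_interior (region d) \<inter> closed_segment (0, 0) (seg_end t). fst p < fst q)"

definition passage :: "fraction \<Rightarrow> cell list" where
  "passage t = (THE cs. distinct cs \<and> set cs = {c \<in> pre_snake_cells t. met_by_segment t c} \<and>
      sorted_wrt (passed_before t) cs)"

definition quadrilateral :: "point set \<Rightarrow> bool" where
  "quadrilateral S \<longleftrightarrow> polytope S \<and> aff_dim S = 2 \<and> card {x. x extreme_point_of S} = 4"

datatype sign = Minus | Plus

definition triangle_sign :: "fraction \<Rightarrow> cell \<Rightarrow> sign" where
  "triangle_sign t c =
    (if c = hd (passage t) \<or> quadrilateral (region c \<inter> on_or_above t) then Minus else Plus)"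

fun F_signs :: "nat \<Rightarrow> fraction \<Rightarrow> cell \<Rightarrow> sign list" where
  "F_signs k t (Triangle p q r) = [triangle_sign t (Triangle p q r)]"
| "F_signs k t (Edge p q) = replicate k (if midpoint p q \<in> on_or_above t then Minus else Plus)"

definition central_edge :: "fraction \<Rightarrow> cell \<Rightarrow> bool" where
  "central_edge t c \<longleftrightarrow> (\<exists>p q. c = Edge p q) \<and> midpoint (0, 0) (seg_end t) \<in> region c"

definition G_signs :: "nat \<Rightarrow> fraction \<Rightarrow> cell \<Rightarrow> sign list" where
  "G_signs k t c = (if central_edge t c then replicate k Plus else F_signs k t c)"


function block_lengths :: "'a list \<Rightarrow> nat list" where
  "block_lengths [] = []"
| "block_lengths (x # xs) =
     Suc (length (takeWhile (\<lambda>y. y = x) xs)) # block_lengths (dropWhile (\<lambda>y. y = x) xs)"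
  by pat_completeness auto
termination
  by (relation "Wellfounded.measure length") (auto simp: less_Suc_eq_le length_dropWhile_le)

text \<open>The value on the empty list is a junk value that never arises here.\<close>

fun cfrac_value :: "nat list \<Rightarrow> real" where
  "cfrac_value [] = 0"
| "cfrac_value [a] = real a"
| "cfrac_value (a # b # as) = real a + 1 / cfrac_value (b # as)"

definition F_plus :: "nat \<Rightarrow> fraction \<Rightarrow> real" where
  "F_plus k t = cfrac_value (block_lengths (concat (map (F_signs k t) (passage t))))"

definition G_plus :: "nat \<Rightarrow> fraction \<Rightarrow> real" where
  "G_plus k t = cfrac_value (block_lengths (concat (map (G_signs k t) (passage t))))"

end

theory Submission
  imports Defs
begin

text \<open>
  Replacing each \<open>-\<close> by \<open>[[1,1],[0,1]]\<close> and each \<open>+\<close> by \<open>[[1,0],[1,1]]\<close> turns a sign word that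
  starts with \<open>-\<close> and ends with \<open>+\<close> into a matrix whose first column is the numerator and
  denominator of its continued fraction. Let \<open>M\<^sub>t\<close> be the matrix of the word of \<open>F\<^sup>+(k,t)\<close>.
  The point reflection in the midpoint of the segment reverses the word and exchanges the signs,
  except that it moves the midpoint to the other side; hence the word of \<open>G\<^sup>+(k,t)\<close> has the
  transposed matrix. The reflection in \<open>y = x\<close> exchanges all signs but the first and the last,
  which turns a first column \<open>(p, q)\<close> into \<open>(p, p - q)\<close> and reduces slopes above 1 to slopes below 1.

  For a Farey triple \<open>(r,t,s)\<close> the segment of \<open>t\<close> runs just above the union of those of \<open>r\<close> and \<open>s\<close>,
  with both midpoints strictly below it. So the word of \<open>t\<close> is glued from the \<open>G\<^sup>+\<close>-words of \<open>r\<close> and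
  \<open>s\<close> and a fixed detour around the common lattice point, that is,
  \<open>M\<^sub>t = M\<^sub>r\<^sup>T [[3k+3,-1],[1,0]] M\<^sub>s\<^sup>T\<close>. By induction along the tree,
  \<open>M\<^sub>t = [[m\<^sub>t, u+k],[u, w]]\<close> with \<open>m\<^sub>r u \<equiv> m\<^sub>s\<close> and \<open>m\<^sub>s (u+k) \<equiv> -m\<^sub>r\<close> modulo \<open>m\<^sub>t\<close>.
\<close>

text \<open>The constant matrix is the detour itself. Passing above the common lattice point costs a
  side, a full square and another side, that is \<open>3 * k + 2\<close> signs \<open>Minus\<close>.
  The right-hand word then starts with \<open>Plus\<close> in place of its initial
  \<open>Minus\<close>, because its starting point now lies below the segment: [[1,3k+2],[0,1]]
  [[1,0],[1,1]] [[1,-1],[0,1]] = [[3k+3,-1],[1,0]]. That the off-diagonal entries differ by k does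
  not follow from this gluing alone. It needs the Markov equation and a relation to the number that
  the Vieta jump replaces. The induction therefore carries exact integer relations between the
  matrices of all three members of a triple; the congruences are their reductions modulo m. The
  residues then are v^- = u + k, v^+ = m - (u + k) and u^- = m - u. To keep geometry out of the
  combinatorics, squares are numbered by the coordinate sum of their lower left corner. Every sign
  is then read off one sequence of residues modulo a + b, and convexity enters only to show that
  this sequence describes the cells actually met.\<close>

fun flip :: "sign \<Rightarrow> sign" where
  "flip Minus = Plus" | "flip Plus = Minus"

section \<open>Sign words, matrices and continued fractions\<close>

type_synonym mat2 = "int \<times> int \<times> int \<times> int"

fun mat2_mult :: "mat2 \<Rightarrow> mat2 \<Rightarrow> mat2" where
  "mat2_mult (a, b, c, d) (a', b', c', d') =
     (a * a' + b * c', a * b' + b * d', c * a' + d * c', c * b' + d * d')"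

fun mat2_transpose :: "mat2 \<Rightarrow> mat2" where
  "mat2_transpose (a, b, c, d) = (a, c, b, d)"

fun sign_matrix :: "sign \<Rightarrow> mat2" where
  "sign_matrix Minus = (1, 1, 0, 1)"
| "sign_matrix Plus = (1, 0, 1, 1)"

fun word_matrix :: "sign list \<Rightarrow> mat2" where
  "word_matrix [] = (1, 0, 0, 1)"
| "word_matrix (s # ss) = mat2_mult (sign_matrix s) (word_matrix ss)"

lemma mat2_mult_assoc: "mat2_mult (mat2_mult A B) C = mat2_mult A (mat2_mult B C)"
  by (cases A; cases B; cases C) (simp add: algebra_simps)

lemma mat2_mult_one [simp]: "mat2_mult (1, 0, 0, 1) A = A" "mat2_mult A (1, 0, 0, 1) = A"
  by (cases A; simp)+

lemma mat2_transpose_mult: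
  "mat2_transpose (mat2_mult A B) = mat2_mult (mat2_transpose B) (mat2_transpose A)"
  by (cases A; cases B) (simp add: algebra_simps)

lemma word_matrix_append:
  "word_matrix (xs @ ys) = mat2_mult (word_matrix xs) (word_matrix ys)"
  by (induction xs) (simp_all add: mat2_mult_assoc)

lemma word_matrix_replicate_Minus: "word_matrix (replicate n Minus) = (1, int n, 0, 1)"
  by (induction n) auto

lemma word_matrix_rev_flip:
  "word_matrix (rev (map flip xs)) = mat2_transpose (word_matrix xs)"
proof (induction xs)
  case (Cons s xs)
  then show ?case
    by (cases s) (simp_all add: word_matrix_append mat2_transpose_mult)
qed simp

lemma word_matrix_det: "word_matrix xs = (p, v, q, w) \<Longrightarrow> p * w - v * q = 1"
proof (induction xs arbitrary: p v q w)
  case (Cons s xs)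
  obtain p' v' q' w' where e: "word_matrix xs = (p', v', q', w')" by (cases "word_matrix xs")
  have "p' * w' - v' * q' = 1" using Cons.IH[OF e] .
  then show ?case using Cons.prems e by (cases s) (auto simp: algebra_simps)
qed auto

lemma word_matrix_first_column_pos:
  "\<lbrakk>xs \<noteq> []; last xs = Plus; word_matrix xs = (p, v, q, w)\<rbrakk> \<Longrightarrow> p > 0 \<and> q > 0"
proof (induction xs arbitrary: p v q w)
  case (Cons s xs)
  obtain p' v' q' w' where e: "word_matrix xs = (p', v', q', w')" by (cases "word_matrix xs")
  show ?case
  proof (cases "xs = []")
    case True
    then show ?thesis using Cons.prems by auto
  next
    case False
    then show ?thesis using Cons.prems Cons.IH[OF _ _ e] e by (cases s) auto
  qed
qed auto

text \<open>These strict bounds later place \<open>u\<close> and \<open>u + k\<close> strictly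
  between 0 and \<open>m\<close>, as the definitions of the residues demand.\<close>

lemma word_matrix_entries_bounds:
  assumes "word_matrix (Minus # ws @ [Plus]) = (p, v, q, w)"
  shows "0 < q" "q < p"
proof -
  obtain p' v' q' w' where e: "word_matrix (ws @ [Plus]) = (p', v', q', w')"
    by (cases "word_matrix (ws @ [Plus])")
  have "p' > 0 \<and> q' > 0" by (rule word_matrix_first_column_pos[OF _ _ e]) auto
  then show "0 < q" "q < p" using assms e by auto
qed

lemma cfrac_value_Suc_hd: "cfrac_value (Suc n # ns) = 1 + cfrac_value (n # ns)"
  by (cases ns) auto

lemma block_lengths_Cons_same:
  "block_lengths (x # x # xs) = Suc (hd (block_lengths (x # xs))) # tl (block_lengths (x # xs))"
  by simp

text \<open>Suffixes of the word may begin with \<open>Plus\<close>, where p and q trade places;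
  hence the two cases. Prepending an equal sign turns the value x into 1 + x, a different one into 1
  + 1/x. The final \<open>Plus\<close> keeps both entries positive.\<close>

lemma cfrac_value_block_lengths:
  assumes "word_matrix xs = (p, v, q, w)" "xs \<noteq> []" "last xs = Plus"
  shows "cfrac_value (block_lengths xs) =
    (if hd xs = Minus then real_of_int p / real_of_int q else real_of_int q / real_of_int p)"
  using assms
proof (induction xs arbitrary: p v q w)
  case (Cons s xs)
  show ?case
  proof (cases xs)
    case Nil
    then show ?thesis using Cons.prems by auto
  next
    case xs: (Cons s' ys)
    obtain p' v' q' w' where e: "word_matrix xs = (p', v', q', w')" by (cases "word_matrix xs")
    have pos: "p' > 0" "q' > 0"
      using word_matrix_first_column_pos[OF _ _ e] xs Cons.prems by auto
    have IH: "cfrac_value (block_lengths xs) =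
        (if s' = Minus then real_of_int p' / real_of_int q' else real_of_int q' / real_of_int p')"
      using Cons.IH[OF e] xs Cons.prems by auto
    have pq: "p = (if s = Minus then p' + q' else p')" "q = (if s = Minus then q' else p' + q')"
      using Cons.prems e by (cases s; auto)+
    show ?thesis
    proof (cases "s = s'")
      case True
      have "cfrac_value (block_lengths (s # xs)) = 1 + cfrac_value (block_lengths xs)"
        unfolding xs True block_lengths_Cons_same cfrac_value_Suc_hd by simp
      then show ?thesis using IH pq pos True by (cases s) (auto simp: field_simps)
    next
      case False
      have "cfrac_value (block_lengths (s # xs)) = 1 + 1 / cfrac_value (block_lengths xs)"
        using False by (auto simp: xs)
      then show ?thesis using IH pq pos False by (cases s; cases s') (auto simp: field_simps)
    qed
  qed
qed simp

section \<open>Sign words of a segment\<close>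

text \<open>The parameter \<open>e\<close> lets one formula serve both constructions:
  \<open>Minus\<close> for F, \<open>Plus\<close> for G. This is legitimate because only the central
  edge has its midpoint on the line.\<close>

definition edge_sign :: "sign \<Rightarrow> int \<Rightarrow> sign" where
  "edge_sign e x = (if x > 0 then Minus else if x < 0 then Plus else e)"

lemma flip_edge_sign: "flip (edge_sign e x) = edge_sign (flip e) (- x)"
  by (simp add: edge_sign_def)

text \<open>With \<open>f(x, y) = b y - a x\<close> and \<open>c = b - a\<close>, let \<open>v n\<close> be the value of \<open>f\<close> at the lower left
  corner of the \<open>n\<close>-th square met by the segment. Then \<open>v n + c\<close> is its value at the upper right
  corner, and \<open>2 * v n + c\<close> and \<open>v n + v (Suc n) + c\<close> are the sums of its values at the endpoints of
  the diagonal of that square and of the side shared with the next one. The sign \<open>e\<close> is given to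
  an edge whose midpoint lies on the line.\<close>

definition square_word :: "sign \<Rightarrow> nat \<Rightarrow> int \<Rightarrow> (nat \<Rightarrow> int) \<Rightarrow> nat \<Rightarrow> sign list" where
  "square_word e k c v n =
     (if v n \<ge> 0 then Minus else Plus) # replicate k (edge_sign e (2 * v n + c)) @
     [if v n + c > 0 then Minus else Plus]"

definition side_word :: "sign \<Rightarrow> nat \<Rightarrow> int \<Rightarrow> (nat \<Rightarrow> int) \<Rightarrow> nat \<Rightarrow> sign list" where
  "side_word e k c v n = replicate k (edge_sign e (v n + v (Suc n) + c))"

primrec level_word :: "sign \<Rightarrow> nat \<Rightarrow> int \<Rightarrow> (nat \<Rightarrow> int) \<Rightarrow> nat \<Rightarrow> sign list" where
  "level_word e k c v 0 = square_word e k c v 0"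
| "level_word e k c v (Suc n) = level_word e k c v n @ side_word e k c v n @ square_word e k c v (Suc n)"

lemma level_word_cong:
  assumes "\<And>i. i \<le> n \<Longrightarrow> square_word e k c v i = square_word e' k c' v' i"
    and "\<And>i. i < n \<Longrightarrow> side_word e k c v i = side_word e' k c' v' i"
  shows "level_word e k c v n = level_word e' k c' v' n"
  using assms by (induction n) auto

lemma square_word_shift: "square_word e k c (\<lambda>i. v (m + i)) n = square_word e k c v (m + n)"
  by (simp add: square_word_def)

lemma side_word_shift: "side_word e k c (\<lambda>i. v (m + i)) n = side_word e k c v (m + n)"
  by (simp add: side_word_def)

lemma level_word_split:
  "level_word e k c v (Suc (m + n)) =
   level_word e k c v m @ side_word e k c v m @ level_word e k c (\<lambda>i. v (Suc m + i)) n"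
proof (induction n)
  case 0
  then show ?case by (simp add: square_word_def)
next
  case (Suc n)
  have "level_word e k c v (Suc (m + Suc n)) = level_word e k c v (Suc (m + n)) @
      side_word e k c v (Suc m + n) @ square_word e k c v (Suc m + Suc n)" by simp
  then show ?case unfolding Suc by (simp add: square_word_shift side_word_shift del: add_Suc add_Suc_right)
qed

lemma level_word_split_first:
  "level_word e k c v (Suc n) = square_word e k c v 0 @ side_word e k c v 0 @ level_word e k c (\<lambda>i. v (Suc i)) n"
  using level_word_split[of e k c v 0 n] by simp

text \<open>The point reflection turns the upper right corner, of height \<open>v + c\<close>, into
  a lower left corner of height \<open>- c - v\<close>. One triangle is tested by
  \<open>\<ge>\<close> and the other by \<open>>\<close> so that the reflection exchanges the two
  tests.\<close>

lemma flip_square_word: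
  "rev (map flip (square_word e k c v i)) = square_word (flip e) k c (\<lambda>j. - c - v j) i"
  by (simp add: square_word_def flip_edge_sign algebra_simps)

lemma rev_flip_level_word:
  "rev (map flip (level_word e k c v n)) = level_word (flip e) k c (\<lambda>i. - c - v (n - i)) n"
proof (induction n arbitrary: v)
  case 0
  then show ?case by (simp add: flip_square_word) (simp add: square_word_def)
next
  case (Suc n)
  have "rev (map flip (level_word e k c v (Suc n))) =
    rev (map flip (square_word e k c v (Suc n))) @ rev (map flip (side_word e k c v n)) @
    rev (map flip (level_word e k c v n))" by simp
  also have "\<dots> = square_word (flip e) k c (\<lambda>i. - c - v (Suc n - i)) 0 @
      side_word (flip e) k c (\<lambda>i. - c - v (Suc n - i)) 0 @
      level_word (flip e) k c (\<lambda>i. - c - v (Suc n - Suc i)) n"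
    unfolding Suc flip_square_word
    by (simp add: square_word_def side_word_def flip_edge_sign algebra_simps)
  also have "\<dots> = level_word (flip e) k c (\<lambda>i. - c - v (Suc n - i)) (Suc n)"
    unfolding level_word_split_first ..
  finally show ?case .
qed

text \<open>The lower left corner \<open>(x, y)\<close> of the \<open>n\<close>-th square is determined by \<open>x + y = n\<close> and
  \<open>-b < b y - a x < a\<close>, so \<open>b y - a x\<close> is a residue of \<open>b n\<close> modulo \<open>a + b\<close>.\<close>

definition level :: "int \<Rightarrow> int \<Rightarrow> nat \<Rightarrow> int" where
  "level a b n = b * (int n + 1) mod (a + b) - b"

lemma level_unique:
  assumes "- b < x" "x < a" "(a + b) dvd (b * int n - x)"
  shows "level a b n = x"
proof -
  obtain z where z: "b * int n - x = (a + b) * z" using assms(3) ..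
  have "b * (int n + 1) = (x + b) + (a + b) * z" using z by (simp add: algebra_simps)
  then have "b * (int n + 1) mod (a + b) = (x + b) mod (a + b)" by simp
  also have "\<dots> = x + b" using assms by (intro mod_pos_pos_trivial) auto
  finally show ?thesis by (simp add: level_def)
qed

lemma level_dvd: "(a + b) dvd (b * int n - level a b n)"
proof -
  have "b * int n - level a b n = b * (int n + 1) - b * (int n + 1) mod (a + b)"
    by (simp add: level_def algebra_simps)
  then show ?thesis by (metis dvd_minus_mod)
qed

text \<open>The excluded value \<open>- b\<close> belongs to remainder 0; as \<open>b\<close> is a
  unit modulo \<open>a + b\<close>, it would force \<open>a + b\<close> to divide
  \<open>n + 1\<close>.\<close>

lemma level_bounds:
  assumes "coprime a b" "a + b > 0" "int n + 1 < a + b"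
  shows "- b < level a b n" "level a b n < a"
proof -
  have "coprime (a + b) b" using assms(1) by (metis coprime_iff_gcd_eq_1 gcd_add1)
  have "b * (int n + 1) mod (a + b) \<noteq> 0"
  proof
    assume "b * (int n + 1) mod (a + b) = 0"
    then have "(a + b) dvd b * (int n + 1)" by auto
    then have "(a + b) dvd int n + 1" using \<open>coprime (a + b) b\<close> coprime_dvd_mult_right_iff by blast
    then show False using assms(3) by (auto dest: zdvd_imp_le)
  qed
  then have "b * (int n + 1) mod (a + b) > 0"
    using assms(2) by (simp add: order_less_le)
  then show "- b < level a b n" by (simp add: level_def)
  have "b * (int n + 1) mod (a + b) < a + b" using assms(2) by simp
  then show "level a b n < a" by (simp add: level_def)
qed

lemma level_0: "\<lbrakk>a > 0; b > 0\<rbrakk> \<Longrightarrow> level a b 0 = 0"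
  by (rule level_unique) auto

lemma level_last: "\<lbrakk>a > 0; b > 0; int n = a + b - 2\<rbrakk> \<Longrightarrow> level a b n = a - b"
proof (rule level_unique)
  assume n: "int n = a + b - 2"
  have "b * int n - (a - b) = (a + b) * (b - 1)" unfolding n by (simp add: algebra_simps)
  then show "(a + b) dvd b * int n - (a - b)" by simp
qed auto

text \<open>The reflection in the midpoint of the segment sends the lower left corner of square
  \<open>i\<close> to the upper right corner of square \<open>n - i\<close> and negates b y - a
  x.\<close>

lemma level_reverse:
  assumes "coprime a b" "a > 0" "b > 0" "int n = a + b - 2" "i \<le> n"
  shows "level a b (n - i) = a - b - level a b i"
proof (rule level_unique)
  show "- b < a - b - level a b i" "a - b - level a b i < a"
    using level_bounds[of a b i] assms by auto
  have i: "int (n - i) = a + b - 2 - int i" using assms by simp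
  have "b * int (n - i) - (a - b - level a b i) = (a + b) * (b - 1) - (b * int i - level a b i)"
    unfolding i by (simp add: algebra_simps)
  then show "(a + b) dvd b * int (n - i) - (a - b - level a b i)"
    by (metis dvd_diff dvd_triv_left level_dvd)
qed

text \<open>Holds because \<open>a\<close> is congruent to \<open>- b\<close> modulo
  \<open>a + b\<close>.\<close>

lemma level_swap:
  assumes "coprime a b" "a > 0" "b > 0" "int i + 1 < a + b"
  shows "level b a i = - level a b i"
proof (rule level_unique)
  show "- a < - level a b i" "- level a b i < b" using level_bounds[of a b i] assms by auto
  have "a * int i - - level a b i = (a + b) * int i - (b * int i - level a b i)"
    by (simp add: algebra_simps)
  then show "(b + a) dvd a * int i - - level a b i" using level_dvd[of a b i] by (metis add.commute dvd_diff dvd_triv_left)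
qed

text \<open>This is the absence of lattice points inside the segment: \<open>b\<close> is invertible
  modulo \<open>a + b\<close>.\<close>

lemma level_zero_iff:
  assumes "coprime a b" "a > 0" "b > 0" "int i + 1 < a + b"
  shows "level a b i = 0 \<longleftrightarrow> i = 0"
proof
  assume "level a b i = 0"
  then have "(a + b) dvd b * int i" using level_dvd[of a b i] by simp
  moreover have "coprime (a + b) b" using assms(1) by (metis coprime_iff_gcd_eq_1 gcd_add1)
  ultimately have "(a + b) dvd int i" using coprime_dvd_mult_right_iff by blast
  then show "i = 0" using assms(2-4) zdvd_imp_le[of "a + b" "int i"] by (cases i) auto
qed (use assms level_0 in auto)


lemma level_end_iff:
  assumes "coprime a b" "a > 0" "b > 0" "int i + 1 < a + b"
  shows "level a b i + (b - a) = 0 \<longleftrightarrow> int i = a + b - 2"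
proof
  define n where "n = nat (a + b - 2)"
  have n: "int n = a + b - 2" using assms by (simp add: n_def)
  assume "level a b i + (b - a) = 0"
  then have "level a b (n - i) = 0" using level_reverse[OF assms(1-3) n, of i] assms n by simp
  then have "n - i = 0" using level_zero_iff[OF assms(1-3), of "n - i"] n by auto
  then show "int i = a + b - 2" using n assms by simp
qed (use level_last assms in auto)

definition fraction_word :: "sign \<Rightarrow> nat \<Rightarrow> int \<Rightarrow> int \<Rightarrow> sign list" where
  "fraction_word e k a b = level_word e k (b - a) (level a b) (nat (a + b - 2))"

lemma fraction_word_reverse:
  assumes "coprime a b" "a > 0" "b > 0"
  shows "rev (map flip (fraction_word e k a b)) = fraction_word (flip e) k a b"
proof -
  have "level_word (flip e) k (b - a) (\<lambda>i. - (b - a) - level a b (nat (a + b - 2) - i)) (nat (a + b - 2)) =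
    level_word (flip e) k (b - a) (level a b) (nat (a + b - 2))"
    using level_reverse[OF assms, of "nat (a + b - 2)"] assms
    by (intro level_word_cong) (auto simp: square_word_def side_word_def)
  then show ?thesis unfolding fraction_word_def rev_flip_level_word .
qed

lemma fraction_word_matrix_transpose:
  assumes "coprime a b" "a > 0" "b > 0"
  shows "word_matrix (fraction_word Plus k a b) = mat2_transpose (word_matrix (fraction_word Minus k a b))"
  using fraction_word_reverse[OF assms, of Minus k] word_matrix_rev_flip by (metis flip.simps(1))

text \<open>Negation exchanges the signs only where the compared value is nonzero. Zero occurs at
  the first corner and possibly at the last one, so these two signs are kept out of
  \<open>ws\<close>.\<close>

lemma level_word_negate:
  assumes "v 0 = 0" "\<And>i. 0 < i \<Longrightarrow> i \<le> n \<Longrightarrow> v i \<noteq> 0" "\<And>i. i < n \<Longrightarrow> v i + c \<noteq> 0"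
  shows "\<exists>ws. level_word e k c v n = Minus # ws @ [if v n + c > 0 then Minus else Plus] \<and>
    level_word (flip e) k (- c) (\<lambda>i. - v i) n =
      Minus # map flip ws @ [if v n + c < 0 then Minus else Plus]"
  using assms
proof (induction n)
  case 0
  then show ?case
    by (intro exI[of _ "replicate k (edge_sign e (2 * v 0 + c))"])
      (auto simp: square_word_def flip_edge_sign)
next
  case (Suc n)
  then obtain ws where
    ws: "level_word e k c v n = Minus # ws @ [if v n + c > 0 then Minus else Plus]"
      "level_word (flip e) k (- c) (\<lambda>i. - v i) n =
        Minus # map flip ws @ [if v n + c < 0 then Minus else Plus]" by auto
  have nz: "v n + c \<noteq> 0" "v (Suc n) \<noteq> 0" using Suc.prems by auto
  show ?case
    using nz
    by (intro exI[of _ "ws @ [if v n + c > 0 then Minus else Plus] @ side_word e k c v n @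
        (if v (Suc n) \<ge> 0 then Minus else Plus) # replicate k (edge_sign e (2 * v (Suc n) + c))"])
      (auto simp: ws square_word_def side_word_def flip_edge_sign algebra_simps)
qed

text \<open>The reflection in the diagonal \<open>y = x\<close> exchanges above and below, but the first triangle
  keeps its sign by convention and the last one because the segment ends in a vertex of it.\<close>

lemma fraction_word_swap:
  assumes "coprime a b" "a > 0" "b > 0"
  obtains ws where "fraction_word e k a b = Minus # ws @ [Plus]"
    and "fraction_word (flip e) k b a = Minus # map flip ws @ [Plus]"
proof -
  let ?n = "nat (a + b - 2)"
  have n: "int ?n = a + b - 2" using assms by simp
  have "level a b i + (b - a) \<noteq> 0" if "i < ?n" for i
    using level_end_iff[OF assms, of i] that n by auto
  moreover have "level a b i \<noteq> 0" if "0 < i" "i \<le> ?n" for i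
    using level_zero_iff[OF assms, of i] that n by auto
  ultimately obtain ws where ws:
    "level_word e k (b - a) (level a b) ?n =
      Minus # ws @ [if level a b ?n + (b - a) > 0 then Minus else Plus]"
    "level_word (flip e) k (- (b - a)) (\<lambda>i. - level a b i) ?n =
      Minus # map flip ws @ [if level a b ?n + (b - a) < 0 then Minus else Plus]"
    using level_word_negate[of "level a b" ?n "b - a" e k] level_0[OF assms(2,3)] by blast
  have "level_word (flip e) k (a - b) (level b a) ?n = level_word (flip e) k (- (b - a)) (\<lambda>i. - level a b i) ?n"
  proof (rule level_word_cong)
    have swap: "level b a i = - level a b i" if "i \<le> ?n" for i
      using level_swap[OF assms, of i] that n by linarith
    show "square_word (flip e) k (a - b) (level b a) i =
      square_word (flip e) k (- (b - a)) (\<lambda>i. - level a b i) i" if "i \<le> ?n" for i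
      using swap[OF that] by (simp add: square_word_def)
    show "side_word (flip e) k (a - b) (level b a) i =
      side_word (flip e) k (- (b - a)) (\<lambda>i. - level a b i) i" if "i < ?n" for i
      using swap[of i] swap[of "Suc i"] that by (simp add: side_word_def)
  qed
  then show ?thesis using that[of ws] ws level_last[OF assms(2,3) n]
    by (simp add: fraction_word_def add.commute)
qed

section \<open>Gluing the words of two Farey neighbours\<close>

locale farey_pair =
  fixes a1 b1 a2 b2 :: int
  assumes a1: "a1 \<ge> 0" and b1: "b1 \<ge> 1" and a2: "a2 \<ge> 1" and b2: "b2 \<ge> 1"
    and det: "b1 * a2 - a1 * b2 = 1"
begin

abbreviation "N1 \<equiv> a1 + b1"
abbreviation "N2 \<equiv> a2 + b2"

lemma coprime_left: "coprime a1 b1"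
proof (rule coprimeI)
  fix d assume "d dvd a1" "d dvd b1"
  then have "d dvd b1 * a2 - a1 * b2" by simp
  then show "is_unit d" by (simp add: det)
qed

lemma coprime_right: "coprime a2 b2"
proof (rule coprimeI)
  fix d assume "d dvd a2" "d dvd b2"
  then have "d dvd b1 * a2 - a1 * b2" by simp
  then show "is_unit d" by (simp add: det)
qed

text \<open>Since the determinant is 1, (b1, a1) and (b2, a2) form a lattice basis. A point with
  coefficients \<alpha>, \<beta> has coordinate sum \<open>\<alpha> * N1 + \<beta> * N2\<close>, and
  its values of b y - a x for the left, right and mediant fractions are \<beta>, - \<alpha> and
  \<beta> - \<alpha>. The four coefficient lemmas say that, within a range of coordinate sums, the
  sign of one coefficient restricts the other.\<close>

lemma coeff_lower: "\<lbrakk>x = \<alpha> * N1 + \<beta> * N2; x \<ge> 0; \<beta> \<le> -1\<rbrakk> \<Longrightarrow> \<alpha> \<ge> 1"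
proof (rule ccontr)
  assume h: "x = \<alpha> * N1 + \<beta> * N2" "x \<ge> 0" "\<beta> \<le> -1" "\<not> \<alpha> \<ge> 1"
  have "\<alpha> * N1 \<le> 0" using h a1 b1 by (intro mult_nonpos_nonneg) auto
  moreover have "\<beta> * N2 \<le> (-1) * N2" using h a2 b2 by (intro mult_right_mono) auto
  ultimately show False using h a2 b2 unfolding distrib_left by linarith
qed

lemma coeff_upper: "\<lbrakk>x = \<alpha> * N1 + \<beta> * N2; x < d * N1 + N2; \<beta> \<ge> 1\<rbrakk> \<Longrightarrow> \<alpha> < d"
proof (rule ccontr)
  assume h: "x = \<alpha> * N1 + \<beta> * N2" "x < d * N1 + N2" "\<beta> \<ge> 1" "\<not> \<alpha> < d"
  have "d * N1 \<le> \<alpha> * N1" using h a1 b1 by (intro mult_right_mono) auto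
  moreover have "1 * N2 \<le> \<beta> * N2" using h a2 b2 by (intro mult_right_mono) auto
  ultimately show False using h unfolding distrib_left by linarith
qed

lemma swap_coeff_lower: "\<lbrakk>x = \<alpha> * N1 + \<beta> * N2; x \<ge> 0; \<alpha> \<le> -1\<rbrakk> \<Longrightarrow> \<beta> \<ge> 1"
proof (rule ccontr)
  assume h: "x = \<alpha> * N1 + \<beta> * N2" "x \<ge> 0" "\<alpha> \<le> -1" "\<not> \<beta> \<ge> 1"
  have "\<beta> * N2 \<le> 0" using h a2 b2 by (intro mult_nonpos_nonneg) auto
  moreover have "\<alpha> * N1 \<le> (-1) * N1" using h a1 b1 by (intro mult_right_mono) auto
  ultimately show False using h a1 b1 unfolding distrib_left by linarith
qed

lemma swap_coeff_upper: "\<lbrakk>x = \<alpha> * N1 + \<beta> * N2; x < d * N2 + N1; \<alpha> \<ge> 1\<rbrakk> \<Longrightarrow> \<beta> < d"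
proof (rule ccontr)
  assume h: "x = \<alpha> * N1 + \<beta> * N2" "x < d * N2 + N1" "\<alpha> \<ge> 1" "\<not> \<beta> < d"
  have "d * N2 \<le> \<beta> * N2" using h a2 b2 by (intro mult_right_mono) auto
  moreover have "1 * N1 \<le> \<alpha> * N1" using h a1 b1 by (intro mult_right_mono) auto
  ultimately show False using h unfolding distrib_left by linarith
qed

text \<open>Here \<open>x\<close> is the coordinate sum of a doubled midpoint. If \<beta> = 0, then
  \<alpha> > 0: the midpoint of the left segment falls strictly below the mediant, which turns the
  tie-break \<open>Minus\<close> into \<open>Plus\<close>. The tie \<alpha> = \<beta> = 1 is the
  midpoint of the mediant, where both sides give \<open>Minus\<close>.\<close>

lemma edge_sign_first:
  assumes "x = \<alpha> * N1 + \<beta> * N2" "0 < x" "x < 2 * N1"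
  shows "edge_sign Minus (\<beta> - \<alpha>) = edge_sign Plus \<beta>"
proof -
  consider "\<beta> \<le> -1" | "\<beta> = 0" | "\<beta> \<ge> 1" by linarith
  then show ?thesis
  proof cases
    case 1
    then show ?thesis using coeff_lower[OF assms(1)] assms(2) by (simp add: edge_sign_def)
  next
    case 2
    then have "\<alpha> > 0" using assms a1 b1 by (simp add: zero_less_mult_iff)
    then show ?thesis using 2 by (simp add: edge_sign_def)
  next
    case 3
    then have "\<alpha> < 2" using coeff_upper[OF assms(1), of 2] assms a2 b2 by simp
    then show ?thesis using 3 by (simp add: edge_sign_def)
  qed
qed

text \<open>The coefficients are relative to the common lattice point (b1, a1); doubling it adds 2
  to \<alpha>, hence the shift by 2.\<close>

lemma edge_sign_second:
  assumes "x = \<alpha> * N1 + \<beta> * N2" "0 < x" "x < 2 * N2"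
  shows "edge_sign Minus (\<beta> - \<alpha> - 2) = edge_sign Plus (- \<alpha>)"
proof -
  consider "\<alpha> \<le> -1" | "\<alpha> = 0" | "\<alpha> \<ge> 1" by linarith
  then show ?thesis
  proof cases
    case 1
    then show ?thesis using swap_coeff_lower[OF assms(1)] assms(2) by (simp add: edge_sign_def)
  next
    case 2
    then have "\<beta> * N2 < 2 * N2" using assms by simp
    then have "\<beta> < 2" using a2 b2 mult_less_cancel_right_pos[of N2 \<beta> 2] by simp
    then show ?thesis using 2 by (simp add: edge_sign_def)
  next
    case 3
    then have "\<beta> < 2" using swap_coeff_upper[OF assms(1), of 2] assms a1 b1 by simp
    then show ?thesis using 3 by (simp add: edge_sign_def)
  qed
qed

abbreviation "v1 \<equiv> level a1 b1"
abbreviation "v2 \<equiv> level a2 b2"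
abbreviation "v \<equiv> level (a1 + a2) (b1 + b2)"

text \<open>For x + y = n the value b y - a x equals b n - (a + b) x; the abscissa here is
  \<open>\<alpha> * b1 + \<beta> * b2\<close>.\<close>

lemma dvd_combination:
  "(a1 + a2 + (b1 + b2)) dvd (b1 + b2) * (\<alpha> * N1 + \<beta> * N2) - (\<beta> - \<alpha>)"
proof -
  have e: "b1 * a2 = 1 + a1 * b2" using det by simp
  have "(b1 + b2) * N1 = (a1 + a2 + (b1 + b2)) * b1 - 1"
    "(b1 + b2) * N2 = (a1 + a2 + (b1 + b2)) * b2 + 1"
    using e by (simp_all add: algebra_simps)
  then have "(b1 + b2) * (\<alpha> * N1 + \<beta> * N2) - (\<beta> - \<alpha>) = (a1 + a2 + (b1 + b2)) * (\<alpha> * b1 + \<beta> * b2)"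
    by algebra
  then show ?thesis by simp
qed

lemma level_first:
  assumes "int i + 1 < N1"
  obtains \<alpha> where "int i = \<alpha> * N1 + v1 i * N2" "v i = v1 i - \<alpha>"
proof -
  obtain z where z: "b1 * int i - v1 i = N1 * z" using level_dvd[of a1 b1 i] ..
  \<comment> \<open>\<open>z\<close> is the abscissa of the corner, so this is a2 x - b2 y, its
    coefficient of (b1, a1).\<close>
  define \<alpha> where "\<alpha> = z * N2 - b2 * int i"
  have e: "b1 * a2 = 1 + a1 * b2" using det by simp
  have i: "int i = \<alpha> * N1 + v1 i * N2"
    unfolding \<alpha>_def using z e by algebra
  have bd: "- b1 < v1 i" "v1 i < a1" using level_bounds[OF coprime_left _ assms] assms by auto
  have "v i = v1 i - \<alpha>"
  proof (rule level_unique)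
    \<comment> \<open>The upper left corner, and below it the lower right one, stay on their sides
      of the line when the left fraction is replaced by the mediant; so the square is still
      met.\<close>
    have "int i + 1 = (\<alpha> - b2) * N1 + (v1 i + b1) * N2" using i e by algebra
    then have "\<alpha> - b2 < 1" using coeff_upper[of "int i + 1" "\<alpha> - b2" "v1 i + b1" 1] bd assms a2 b2 by simp
    then show "- (b1 + b2) < v1 i - \<alpha>" using bd by simp
    have "int i + 1 = (\<alpha> + a2) * N1 + (v1 i - a1) * N2" using i e by algebra
    then have "\<alpha> + a2 \<ge> 1" using coeff_lower[of "int i + 1" "\<alpha> + a2" "v1 i - a1"] bd by simp
    then show "v1 i - \<alpha> < a1 + a2" using bd by simp
    show "(a1 + a2 + (b1 + b2)) dvd (b1 + b2) * int i - (v1 i - \<alpha>)"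
      by (subst i) (rule dvd_combination)
  qed
  then show ?thesis using that i by blast
qed

lemma level_second:
  assumes "int i + 1 < N2" "int n = N1 + int i"
  obtains \<beta> where "int i = - v2 i * N1 + \<beta> * N2" "v n = v2 i + \<beta> - 1"
proof -
  obtain z where z: "b2 * int i - v2 i = N2 * z" using level_dvd[of a2 b2 i] ..
  \<comment> \<open>With the abscissa \<open>z\<close> measured from the common lattice point, this
    is b1 y - a1 x, the coefficient of (b2, a2).\<close>
  define \<beta> where "\<beta> = b1 * int i - z * N1"
  have e: "b1 * a2 = 1 + a1 * b2" using det by simp
  have i: "int i = - v2 i * N1 + \<beta> * N2"
    unfolding \<beta>_def using z e by algebra
  have bd: "- b2 < v2 i" "v2 i < a2" using level_bounds[OF coprime_right _ assms(1)] assms(1) by auto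
  have "v n = v2 i + \<beta> - 1"
  proof (rule level_unique)
    have "int i + 1 = (- v2 i - b2) * N1 + (\<beta> + b1) * N2" using i e by algebra
    then have "\<beta> + b1 \<ge> 1" using swap_coeff_lower[of "int i + 1" "- v2 i - b2" "\<beta> + b1"] bd by simp
    then show "- (b1 + b2) < v2 i + \<beta> - 1" using bd by simp
    have "int i + 1 = (a2 - v2 i) * N1 + (\<beta> - a1) * N2" using i e by algebra
    then have "\<beta> - a1 < 1" using swap_coeff_upper[of "int i + 1" "a2 - v2 i" "\<beta> - a1" 1] bd assms(1) a1 b1 by simp
    then show "v2 i + \<beta> - 1 < a1 + a2" using bd by simp
    have "int n = (1 - v2 i) * N1 + \<beta> * N2" using i assms(2) by (simp add: algebra_simps)
    moreover have "v2 i + \<beta> - 1 = \<beta> - (1 - v2 i)" by simp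
    ultimately show "(a1 + a2 + (b1 + b2)) dvd (b1 + b2) * int n - (v2 i + \<beta> - 1)"
      using dvd_combination[of "1 - v2 i" \<beta>] by metis
  qed
  then show ?thesis using that i by blast
qed


lemma square_word_first:
  assumes "int i + 1 < N1"
  shows "square_word Minus k (b1 + b2 - (a1 + a2)) v i = square_word Plus k (b1 - a1) v1 i"
proof -
  obtain \<alpha> where i: "int i = \<alpha> * N1 + v1 i * N2" and v: "v i = v1 i - \<alpha>"
    using level_first[OF assms] by blast
  have e: "b1 * a2 = 1 + a1 * b2" using det by simp
  have d: "edge_sign Minus (2 * v i + (b1 + b2 - (a1 + a2))) = edge_sign Plus (2 * v1 i + (b1 - a1))"
  proof -
    \<comment> \<open>The doubled midpoint of the diagonal is twice the lower left corner plus (1,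
      1), and (1, 1) has coefficients \<open>a2 - b2\<close> and \<open>b1 - a1\<close>.\<close>
    have "2 * int i + 2 = (2 * \<alpha> + a2 - b2) * N1 + (2 * v1 i + (b1 - a1)) * N2"
      using i e by algebra
    from edge_sign_first[OF this] assms show ?thesis by (simp add: v algebra_simps)
  qed
  have t1: "v i \<ge> 0 \<longleftrightarrow> v1 i \<ge> 0"
  proof -
    consider "v1 i \<le> -1" | "v1 i = 0" | "v1 i \<ge> 1" by linarith
    then show ?thesis
    proof cases
      case 1
      then show ?thesis using coeff_lower[OF i] by (simp add: v)
    next
      case 2
      \<comment> \<open>\<open>v1 i < a1\<close> supplies \<open>a1 > 0\<close>, since the locale
        admits \<open>a1 = 0\<close>.\<close>
      then have "i = 0"
        using level_zero_iff[OF coprime_left _ _ assms] level_bounds[OF coprime_left _ assms] assms b1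
        by simp
      then have "\<alpha> = 0" using i 2 assms by simp
      then show ?thesis using 2 by (simp add: v)
    next
      case 3
      then have "\<alpha> < 1" using coeff_upper[OF i, of 1] assms a2 b2 by simp
      then show ?thesis using 3 by (simp add: v)
    qed
  qed
  have t2: "v i + (b1 + b2 - (a1 + a2)) > 0 \<longleftrightarrow> v1 i + (b1 - a1) > 0"
  proof -
    have i2: "int i + 2 = (\<alpha> + a2 - b2) * N1 + (v1 i + (b1 - a1)) * N2"
      using i e by algebra
    consider "v1 i + (b1 - a1) \<le> -1" | "v1 i + (b1 - a1) = 0" | "v1 i + (b1 - a1) \<ge> 1" by linarith
    then show ?thesis
    proof cases
      case 1
      then show ?thesis using coeff_lower[OF i2] by (simp add: v)
    next
      case 2
      then have "(\<alpha> + a2 - b2) * N1 > 0" using i2 by simp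
      then have "\<alpha> + a2 - b2 > 0" using assms by (simp add: zero_less_mult_iff)
      then show ?thesis using 2 by (simp add: v)
    next
      case 3
      then have "\<alpha> + a2 - b2 < 1" using coeff_upper[OF i2, of 1] assms a2 b2 by simp
      then show ?thesis using 3 by (simp add: v)
    qed
  qed
  show ?thesis unfolding square_word_def d t1 t2 ..
qed

lemma side_word_first:
  assumes "int i + 2 < N1"
  shows "side_word Minus k (b1 + b2 - (a1 + a2)) v i = side_word Plus k (b1 - a1) v1 i"
proof -
  obtain \<alpha> where i: "int i = \<alpha> * N1 + v1 i * N2" and v: "v i = v1 i - \<alpha>"
    using level_first[of i] assms by auto
  obtain \<alpha>' where i': "int (Suc i) = \<alpha>' * N1 + v1 (Suc i) * N2" and v': "v (Suc i) = v1 (Suc i) - \<alpha>'"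
    using level_first[of "Suc i"] assms by auto
  have e: "b1 * a2 = 1 + a1 * b2" using det by simp
  have "2 * int i + 3 = (\<alpha> + \<alpha>' + a2 - b2) * N1 + (v1 i + v1 (Suc i) + (b1 - a1)) * N2"
    using i i'[unfolded of_nat_Suc] e by algebra
  from edge_sign_first[OF this] assms show ?thesis by (simp add: side_word_def v v' algebra_simps)
qed

text \<open>For \<open>i = 0\<close> the lower left corner is the common lattice point. It starts
  the right segment, hence \<open>Minus\<close> there, but lies strictly below the mediant, hence
  \<open>Plus\<close> here.\<close>

lemma square_word_second:
  assumes "int i + 1 < N2" "int n = N1 + int i"
  shows "tl (square_word Minus k (b1 + b2 - (a1 + a2)) v n) = tl (square_word Plus k (b2 - a2) v2 i)"
    and "hd (square_word Minus k (b1 + b2 - (a1 + a2)) v n) =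
      (if i = 0 then Plus else hd (square_word Plus k (b2 - a2) v2 i))"
proof -
  obtain \<beta> where i: "int i = - v2 i * N1 + \<beta> * N2" and v: "v n = v2 i + \<beta> - 1"
    using level_second[OF assms] by blast
  have e: "b1 * a2 = 1 + a1 * b2" using det by simp
  have d: "edge_sign Minus (2 * v n + (b1 + b2 - (a1 + a2))) = edge_sign Plus (2 * v2 i + (b2 - a2))"
  proof -
    have "2 * int i + 2 = (- (2 * v2 i + (b2 - a2))) * N1 + (2 * \<beta> + b1 - a1) * N2"
      using i e by algebra
    from edge_sign_second[OF this] assms show ?thesis by (simp add: v algebra_simps)
  qed
  have t2: "v n + (b1 + b2 - (a1 + a2)) > 0 \<longleftrightarrow> v2 i + (b2 - a2) > 0"
  proof -
    have i2: "int i + 2 = (- (v2 i + (b2 - a2))) * N1 + (\<beta> + b1 - a1) * N2"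
      using i e by algebra
    consider "v2 i + (b2 - a2) \<ge> 1" | "v2 i + (b2 - a2) = 0" | "v2 i + (b2 - a2) \<le> -1" by linarith
    then show ?thesis
    proof cases
      case 1
      then show ?thesis using swap_coeff_lower[OF i2] by (simp add: v)
    next
      case 2
      then have "(\<beta> + b1 - a1) * N2 < 2 * N2" using i2 assms by simp
      then have "\<beta> + b1 - a1 < 2" using a2 b2 mult_less_cancel_right_pos[of N2 _ 2] by simp
      then show ?thesis using 2 by (simp add: v)
    next
      case 3
      then have "\<beta> + b1 - a1 < 2" using swap_coeff_upper[OF i2, of 2] assms a1 b1 a2 b2 by simp
      then show ?thesis using 3 by (simp add: v)
    qed
  qed
  show "tl (square_word Minus k (b1 + b2 - (a1 + a2)) v n) = tl (square_word Plus k (b2 - a2) v2 i)"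
    unfolding square_word_def d t2 by simp
  have "v n \<ge> 0 \<longleftrightarrow> v2 i \<ge> 0 \<and> i \<noteq> 0"
  proof -
    consider "v2 i \<ge> 1" | "v2 i = 0" | "v2 i \<le> -1" by linarith
    then show ?thesis
    proof cases
      case 1
      then have "i \<noteq> 0" using level_0[of a2 b2] a2 b2 by (cases i) auto
      then show ?thesis using 1 swap_coeff_lower[OF i] by (simp add: v)
    next
      case 2
      then have "i = 0" using level_zero_iff[OF coprime_right _ _ assms(1)] a2 b2 by simp
      then have "\<beta> * N2 = 0" using i 2 by simp
      then have "\<beta> = 0" using a2 b2 by simp
      then show ?thesis using \<open>i = 0\<close> 2 by (simp add: v)
    next
      case 3
      then have "\<beta> < 1" using swap_coeff_upper[OF i, of 1] assms a1 b1 by simp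
      then show ?thesis using 3 by (simp add: v)
    qed
  qed
  then show "hd (square_word Minus k (b1 + b2 - (a1 + a2)) v n) =
      (if i = 0 then Plus else hd (square_word Plus k (b2 - a2) v2 i))"
    by (simp add: square_word_def)
qed

lemma side_word_second:
  assumes "int i + 2 < N2" "int n = N1 + int i"
  shows "side_word Minus k (b1 + b2 - (a1 + a2)) v n = side_word Plus k (b2 - a2) v2 i"
proof -
  obtain \<beta> where i: "int i = - v2 i * N1 + \<beta> * N2" and v: "v n = v2 i + \<beta> - 1"
    using level_second[of i n] assms by auto
  obtain \<beta>' where i': "int (Suc i) = - v2 (Suc i) * N1 + \<beta>' * N2" and v': "v (Suc n) = v2 (Suc i) + \<beta>' - 1"
    using level_second[of "Suc i" "Suc n"] assms by auto
  have e: "b1 * a2 = 1 + a1 * b2" using det by simp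
  have "2 * int i + 3 = (- (v2 i + v2 (Suc i) + (b2 - a2))) * N1 + (\<beta> + \<beta>' + b1 - a1) * N2"
    using i i'[unfolded of_nat_Suc] e by algebra
  from edge_sign_second[OF this] assms show ?thesis by (simp add: side_word_def v v' algebra_simps)
qed

lemma level_word_second:
  assumes "int i + 1 < N2" "int n = N1"
  shows "level_word Minus k (b1 + b2 - (a1 + a2)) (\<lambda>j. v (n + j)) i =
    Plus # tl (level_word Plus k (b2 - a2) v2 i)"
  using assms(1)
proof (induction i)
  case 0
  have "square_word Minus k (b1 + b2 - (a1 + a2)) v n = Plus # tl (square_word Plus k (b2 - a2) v2 0)"
    using square_word_second[of 0 n k] 0 assms(2) by (simp add: square_word_def)
  then show ?case by (simp add: square_word_def)
next
  case (Suc i)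
  have IH: "level_word Minus k (b1 + b2 - (a1 + a2)) (\<lambda>j. v (n + j)) i =
    Plus # tl (level_word Plus k (b2 - a2) v2 i)"
    using Suc by simp
  have "square_word Minus k (b1 + b2 - (a1 + a2)) v (n + Suc i) = square_word Plus k (b2 - a2) v2 (Suc i)"
    using square_word_second[of "Suc i" "n + Suc i" k] Suc.prems assms(2) by (simp add: square_word_def)
  moreover have "side_word Minus k (b1 + b2 - (a1 + a2)) v (n + i) = side_word Plus k (b2 - a2) v2 i"
    using side_word_second[of i "n + i" k] Suc.prems assms(2) by simp
  moreover have "level_word Plus k (b2 - a2) v2 i \<noteq> []"
    by (cases i) (auto simp: square_word_def)
  ultimately show ?case
    unfolding level_word.simps IH square_word_shift side_word_shift by simp
qed

text \<open>The lower left corners are (b1, a1), (b1 - 1, a1) and (b1 - 1, a1 - 1): the mediant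
  passes the common lattice point on its upper left side.\<close>

lemma middle_levels:
  assumes "int n = N1"
  shows "v n = -1" "v (n - 1) = a1 + a2 - 1" "a1 \<ge> 1 \<Longrightarrow> v (n - 2) = - 1 - (b1 + b2 - (a1 + a2))"
proof -
  have n: "n \<ge> 1" using assms a1 b1 by simp
  have eq: "(b1 + b2) * N1 = (a1 + a2 + (b1 + b2)) * b1 - 1" using det by algebra
  show "v n = -1"
    by (rule level_unique) (use a1 b1 a2 b2 assms eq in auto)
  show "v (n - 1) = a1 + a2 - 1"
  proof (rule level_unique)
    have "int (n - 1) = N1 - 1" using assms n by simp
    then have "(b1 + b2) * int (n - 1) - (a1 + a2 - 1) = (a1 + a2 + (b1 + b2)) * (b1 - 1)"
      using eq by algebra
    then show "(a1 + a2 + (b1 + b2)) dvd (b1 + b2) * int (n - 1) - (a1 + a2 - 1)" by simp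
  qed (use a1 b1 a2 b2 in auto)
  show "v (n - 2) = - 1 - (b1 + b2 - (a1 + a2))" if "a1 \<ge> 1"
  proof (rule level_unique)
    have "int (n - 2) = N1 - 2" using assms that b1 by simp
    then have "(b1 + b2) * int (n - 2) - (- 1 - (b1 + b2 - (a1 + a2))) = (a1 + a2 + (b1 + b2)) * (b1 - 1)"
      using eq by algebra
    then show "(a1 + a2 + (b1 + b2)) dvd (b1 + b2) * int (n - 2) - (- 1 - (b1 + b2 - (a1 + a2)))" by simp
  qed (use a1 b1 a2 b2 that in auto)
qed

text \<open>The square to the upper left of the common lattice point contributes
  \<open>k + 2\<close> signs and the vertical side after it \<open>k\<close>. If
  \<open>a1 = 0\<close>, then \<open>n = 1\<close> and this is already the whole word of the
  mediant.\<close>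

lemma level_word_after_first:
  assumes n: "int n = N1"
  shows "level_word Minus k (b1 + b2 - (a1 + a2)) (\<lambda>i. v (n - 1 + i)) (nat (N2 - 1)) =
    replicate (2 * k + 2) Minus @ Plus # tl (fraction_word Plus k a2 b2)"
proof -
  have n1: "n \<ge> 1" using n a1 b1 by simp
  let ?m = "nat (N2 - 2)"
  have m: "nat (N2 - 1) = Suc (0 + ?m)" using a2 b2 by simp
  have mid: "v n = -1" "v (n - 1) = a1 + a2 - 1" using middle_levels[OF n] by auto
  have "level_word Minus k (b1 + b2 - (a1 + a2)) (\<lambda>i. v (n - 1 + i)) (nat (N2 - 1)) =
    square_word Minus k (b1 + b2 - (a1 + a2)) v (n - 1) @ side_word Minus k (b1 + b2 - (a1 + a2)) v (n - 1) @
    level_word Minus k (b1 + b2 - (a1 + a2)) (\<lambda>i. v (n + i)) ?m"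
    unfolding m level_word_split using n1 by (simp add: square_word_def side_word_def)
  also have "level_word Minus k (b1 + b2 - (a1 + a2)) (\<lambda>i. v (n + i)) ?m = Plus # tl (fraction_word Plus k a2 b2)"
    using level_word_second[of ?m n k] n a2 b2 by (simp add: fraction_word_def)
  also have "square_word Minus k (b1 + b2 - (a1 + a2)) v (n - 1) = replicate (k + 2) Minus"
    using a1 a2 b1 b2 by (simp add: square_word_def mid[simplified] edge_sign_def replicate_append_same)
  also have "side_word Minus k (b1 + b2 - (a1 + a2)) v (n - 1) = replicate k Minus"
    using a1 a2 b1 b2 n1 mid by (simp add: side_word_def edge_sign_def)
  finally show ?thesis by (simp flip: append_assoc replicate_add add: mult_2)
qed

text \<open>No lattice point and no half lattice point other than the midpoints of its sides lies in the
  triangle spanned by the two segments and their sum. Hence the segment of the mediant meets the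
  same cells, on the same sides, as the concatenated segments, except for the detour above the
  lattice point where these are joined; and the two midpoints fall strictly below it.\<close>

lemma fraction_word_mediant:
  assumes "a1 \<ge> 1"
  shows "fraction_word Minus k (a1 + a2) (b1 + b2) =
    fraction_word Plus k a1 b1 @ replicate (3 * k + 2) Minus @ Plus # tl (fraction_word Plus k a2 b2)"
proof -
  define n where "n = nat N1"
  have n: "int n = N1" "n \<ge> 2" using assms b1 by (simp_all add: n_def)
  have mid: "v (n - 1) = a1 + a2 - 1" "v (n - 2) = - 1 - (b1 + b2 - (a1 + a2))"
    using middle_levels[OF n(1)] assms by auto
  let ?m = "nat (N1 - 2)"
  have m: "nat (a1 + a2 + (b1 + b2) - 2) = Suc (?m + nat (N2 - 1))" "Suc ?m = n - 1" "?m = n - 2"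
    using assms b1 a2 b2 by (auto simp: n_def)
  have "fraction_word Minus k (a1 + a2) (b1 + b2) =
    level_word Minus k (b1 + b2 - (a1 + a2)) v ?m @ side_word Minus k (b1 + b2 - (a1 + a2)) v ?m @
    level_word Minus k (b1 + b2 - (a1 + a2)) (\<lambda>i. v (n - 1 + i)) (nat (N2 - 1))"
    unfolding fraction_word_def m(1) level_word_split m(2) ..
  also have "level_word Minus k (b1 + b2 - (a1 + a2)) v ?m = fraction_word Plus k a1 b1"
    unfolding fraction_word_def
    by (rule level_word_cong; rule square_word_first side_word_first) (use assms b1 in auto)
  also have "side_word Minus k (b1 + b2 - (a1 + a2)) v ?m = replicate k Minus"
    using mid m assms a2 n(2) by (simp add: side_word_def edge_sign_def)
  finally have "fraction_word Minus k (a1 + a2) (b1 + b2) = fraction_word Plus k a1 b1 @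
      (replicate k Minus @ replicate (2 * k + 2) Minus) @ Plus # tl (fraction_word Plus k a2 b2)"
    unfolding level_word_after_first[OF n(1)] by simp
  then show ?thesis unfolding replicate_add[symmetric] by simp
qed

text \<open>No square belongs to 0/1, so no horizontal side precedes the detour and \<open>k\<close>
  of its \<open>3 * k + 2\<close> signs are missing.\<close>

lemma fraction_word_mediant_zero:
  assumes "a1 = 0"
  shows "fraction_word Minus k a2 (b1 + b2) =
    replicate (2 * k + 2) Minus @ Plus # tl (fraction_word Plus k a2 b2)"
proof -
  have "b1 = 1" using det assms b1 by (simp add: zmult_eq_1_iff)
  then show ?thesis using level_word_after_first[of 1 k] assms
    by (simp add: fraction_word_def algebra_simps)
qed

end


section \<open>Matrices of fractions along the Farey tree\<close>

text \<open>Here \<open>m3\<close> completes \<open>m1\<close> and \<open>m2\<close> to a vertex of the Markov tree, and the formula for \<open>m\<close>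
  is the Vieta jump replacing \<open>m3\<close>.\<close>

lemma cohn_step:
  fixes k m1 u1 w1 m2 u2 w2 m3 m u v w :: int
  assumes d1: "m1 * w1 - (u1 + k) * u1 = 1" and d2: "m2 * w2 - (u2 + k) * u2 = 1"
    and rel: "m1 * u2 - m2 * u1 = m3 + k * m2"
    and markov: "m1\<^sup>2 + m2\<^sup>2 + m3\<^sup>2 + k * (m1 * m2 + m2 * m3 + m3 * m1) = (3 + 3 * k) * m1 * m2 * m3"
    and pos: "m1 > 0" "m2 > 0"
    and mat: "(m, v, u, w) = mat2_mult (m1, u1, u1 + k, w1)
      ((3 * k + 3) * m2 - (u2 + k), (3 * k + 3) * u2 - w2, m2, u2)"
  shows "v = u + k" and "m = (3 + 3 * k) * m1 * m2 - k * m1 - k * m2 - m3"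
    and "m1 * u - m * u1 = m2 + k * m" and "m * u2 - m2 * u = m1 + k * m2"
proof -
  have m: "m = m1 * ((3 * k + 3) * m2 - (u2 + k)) + u1 * m2"
    and v: "v = m1 * ((3 * k + 3) * u2 - w2) + u1 * u2"
    and u: "u = (u1 + k) * ((3 * k + 3) * m2 - (u2 + k)) + w1 * m2"
    using mat by auto
  \<comment> \<open>The factor \<open>m1 * m2\<close> lets the determinant equations eliminate
    \<open>w1\<close> and \<open>w2\<close>; what remains is a consequence of \<open>rel\<close> and
    the Markov equation.\<close>
  have "m1 * m2 * (v - u - k) = 0"
    unfolding v u using d1 d2 rel markov by algebra
  then show vk: "v = u + k" using pos by simp
  show "m = (3 + 3 * k) * m1 * m2 - k * m1 - k * m2 - m3" unfolding m using rel by algebra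
  show "m1 * u - m * u1 = m2 + k * m" unfolding m u using d1 by algebra
  have "m * u2 - m2 * v = m1" unfolding m v using d2 by algebra
  then show "m * u2 - m2 * u = m1 + k * m2" unfolding vk by (simp add: algebra_simps)
qed

text \<open>The value at \<open>0/1\<close>, which has no word, is the one for which the mediant formula persists.\<close>

definition fraction_matrix :: "nat \<Rightarrow> fraction \<Rightarrow> mat2" where
  "fraction_matrix k r = (if r = (0, 1) then (1, 0, - int k, 1)
     else word_matrix (fraction_word Minus k (int (fst r)) (int (snd r))))"

lemma fraction_word_Cons:
  assumes "coprime a b" "a > 0" "b > 0"
  shows "fraction_word e k a b = Minus # tl (fraction_word e k a b)"
  using fraction_word_swap[OF assms, of e k] by (metis list.sel(3))

lemma fraction_matrix_mediant:
  fixes a1 b1 a2 b2 :: nat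
  assumes det: "int b1 * int a2 - int a1 * int b2 = 1" and pos: "0 < b1" "0 < a2" "0 < b2"
    and m1: "fraction_matrix k (a1, b1) = (m1, v1, u1, w1)"
    and m2: "fraction_matrix k (a2, b2) = (m2, v2, u2, w2)"
  shows "fraction_matrix k (a1 + a2, b1 + b2) = mat2_mult (m1, u1, v1, w1)
      ((3 * int k + 3) * m2 - v2, (3 * int k + 3) * u2 - w2, m2, u2)"
proof -
  interpret farey_pair "int a1" "int b1" "int a2" "int b2"
    using det pos by unfold_locales auto
  have W2: "word_matrix (fraction_word Plus k (int a2) (int b2)) = (m2, u2, v2, w2)"
    using fraction_word_matrix_transpose[OF coprime_right, of k] m2 pos
    by (simp add: fraction_matrix_def)
  obtain p q r s where T: "word_matrix (tl (fraction_word Plus k (int a2) (int b2))) = (p, q, r, s)"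
    by (metis prod.exhaust)
  have "word_matrix (Minus # tl (fraction_word Plus k (int a2) (int b2))) = (m2, u2, v2, w2)"
    using W2 fraction_word_Cons[OF coprime_right] pos by simp
  \<comment> \<open>Removing the initial \<open>Minus\<close> subtracts the second row from the
    first.\<close>
  then have T': "p = m2 - v2" "q = u2 - w2" "r = v2" "s = w2" using T by auto
  have ne: "(a1 + a2, b1 + b2) \<noteq> (0, 1)" using pos by simp
  show ?thesis
  proof (cases "a1 = 0")
    case True
    then have "b1 = 1" using det by (simp add: zmult_eq_1_iff)
    \<comment> \<open>The transpose of this matrix is the power -k of the matrix of
      \<open>Minus\<close>; it lowers the exponent \<open>3 * k + 2\<close> to the
      \<open>2 * k + 2\<close> signs that are present.\<close>
    then have "m1 = 1" "v1 = 0" "u1 = - int k" "w1 = 1"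
      using m1 True by (auto simp: fraction_matrix_def)
    moreover have "fraction_matrix k (a1 + a2, b1 + b2) =
        word_matrix (replicate (2 * k + 2) Minus @ Plus # tl (fraction_word Plus k (int a2) (int b2)))"
      using fraction_word_mediant_zero[of k] True pos by (simp add: fraction_matrix_def)
    ultimately show ?thesis
      unfolding word_matrix_append word_matrix_replicate_Minus
      by (simp add: T T' algebra_simps)
  next
    case False
    have "word_matrix (fraction_word Plus k (int a1) (int b1)) = (m1, u1, v1, w1)"
      using fraction_word_matrix_transpose[OF coprime_left, of k] m1 pos False
      by (simp add: fraction_matrix_def)
    moreover have "fraction_matrix k (a1 + a2, b1 + b2) =
        word_matrix (fraction_word Plus k (int a1) (int b1) @ replicate (3 * k + 2) Minus @
          Plus # tl (fraction_word Plus k (int a2) (int b2)))"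
      using fraction_word_mediant[of k] False ne by (simp add: fraction_matrix_def)
    ultimately show ?thesis
      unfolding word_matrix_append word_matrix_replicate_Minus
      by (simp add: T T' algebra_simps)
  qed
qed

lemma fraction_matrix_det: "fraction_matrix k r = (m, v, u, w) \<Longrightarrow> m * w - v * u = 1"
  by (auto simp: fraction_matrix_def word_matrix_det split: if_splits)

lemma fraction_matrix_one: "fraction_matrix k (1, 1) = (int k + 2, int k + 1, 1, 1)"
proof -
  have "fraction_word Minus k 1 1 = replicate (k + 1) Minus @ [Plus]"
    by (simp add: fraction_word_def square_word_def level_def edge_sign_def)
  then show ?thesis
    by (simp add: fraction_matrix_def word_matrix_append word_matrix_replicate_Minus
      del: replicate_Suc replicate.simps)
qed

text \<open>With v = u + k the last two relations read m1 u - m v1 = m2 and m u2 - m2 v = m1. They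
  are kept exact because each is the hypothesis \<open>rel\<close> of \<open>cohn_mediant\<close>
  for one of the two children. The positive denominators keep 1/0, which has no matrix here, out of
  the triple.\<close>

fun cohn_vertex :: "nat \<Rightarrow> fraction \<times> fraction \<times> fraction \<Rightarrow> int \<times> int \<times> int \<Rightarrow> bool" where
  "cohn_vertex k ((a1, b1), t, (a2, b2)) (m1, m, m2) \<longleftrightarrow>
     int b1 * int a2 - int a1 * int b2 = 1 \<and> 0 < b1 \<and> 0 < a2 \<and> 0 < b2 \<and> t = (a1 + a2, b1 + b2) \<and>
     coprime m1 m \<and> coprime m m2 \<and>
     (\<exists>u1 w1 u w u2 w2. fraction_matrix k (a1, b1) = (m1, u1 + int k, u1, w1) \<and>
        fraction_matrix k t = (m, u + int k, u, w) \<and>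
        fraction_matrix k (a2, b2) = (m2, u2 + int k, u2, w2) \<and>
        m1 * u - m * u1 = m2 + int k * m \<and> m * u2 - m2 * u = m1 + int k * m2)"

text \<open>\<open>m3\<close> and the new number are the two roots of the Markov equation in its
  third variable, so their product is the dividend and the division is exact. Coprimality survives
  because the relations write the remaining outer number as an integer combination of the two in
  question.\<close>

lemma cohn_mediant:
  fixes a1 b1 a2 b2 :: nat
  assumes det: "int b1 * int a2 - int a1 * int b2 = 1" and pos: "0 < b1" "0 < a2" "0 < b2"
    and M1: "fraction_matrix k (a1, b1) = (m1, u1 + int k, u1, w1)"
    and M2: "fraction_matrix k (a2, b2) = (m2, u2 + int k, u2, w2)"
    and rel: "m1 * u2 - m2 * u1 = m3 + int k * m2"
    and markov: "m1\<^sup>2 + m2\<^sup>2 + m3\<^sup>2 + int k * (m1 * m2 + m2 * m3 + m3 * m1) = (3 + 3 * int k) * m1 * m2 * m3"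
    and mpos: "m1 > 0" "m2 > 0" "m3 > 0"
    and cop: "coprime m1 m2"
  shows "cohn_vertex k ((a1, b1), (a1 + a2, b1 + b2), (a2, b2))
    (m1, (m1\<^sup>2 + int k * m1 * m2 + m2\<^sup>2) div m3, m2)"
proof -
  obtain m v u w where M: "fraction_matrix k (a1 + a2, b1 + b2) = (m, v, u, w)"
    by (cases "fraction_matrix k (a1 + a2, b1 + b2)")
  have d1: "m1 * w1 - (u1 + int k) * u1 = 1" and d2: "m2 * w2 - (u2 + int k) * u2 = 1"
    using fraction_matrix_det[OF M1] fraction_matrix_det[OF M2] by auto
  have mm: "(m, v, u, w) = mat2_mult (m1, u1, u1 + int k, w1)
      ((3 * int k + 3) * m2 - (u2 + int k), (3 * int k + 3) * u2 - w2, m2, u2)"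
    using fraction_matrix_mediant[OF det pos M1 M2] M by simp
  note step = cohn_step[OF d1 d2 rel markov mpos(1,2) mm]
  have "m3 * m = m1\<^sup>2 + int k * m1 * m2 + m2\<^sup>2" unfolding step(2) using markov by algebra
  then have m: "(m1\<^sup>2 + int k * m1 * m2 + m2\<^sup>2) div m3 = m"
    using mpos by (metis nonzero_mult_div_cancel_left less_irrefl)
  have "coprime m1 m"
  proof (rule coprimeI)
    fix d assume "d dvd m1" "d dvd m"
    then have "d dvd m1 * u - m * (u1 + int k)" by simp
    also have "m1 * u - m * (u1 + int k) = m2" using step(3) by (simp add: algebra_simps)
    finally show "is_unit d" using \<open>d dvd m1\<close> cop coprime_common_divisor by blast
  qed
  moreover have "coprime m m2"
  proof (rule coprimeI)
    fix d assume "d dvd m" "d dvd m2"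
    then have "d dvd m * u2 - m2 * (u + int k)" by simp
    also have "m * u2 - m2 * (u + int k) = m1" using step(4) by (simp add: algebra_simps)
    finally show "is_unit d" using \<open>d dvd m2\<close> cop coprime_common_divisor by blast
  qed
  ultimately show ?thesis
    using det pos M1 M2 M step m by auto
qed

lemma cohn_vertex_tree: "cohn_vertex k (farey_at (ToLeft # ds)) (markov_at k (ToLeft # ds))"
proof (induction ds rule: rev_induct)
  case Nil
  \<comment> \<open>The pair 0/1, 1/1 comes from the root triple (1, k + 2, 1); the number replaced
    is the 1 attached to 1/0.\<close>
  have "cohn_vertex k ((0, 1), (0 + 1, 1 + 1), (1, 1))
    (1, (1\<^sup>2 + int k * 1 * (int k + 2) + (int k + 2)\<^sup>2) div 1, int k + 2)"
  proof (rule cohn_mediant)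
    show "fraction_matrix k (0, 1) = (1, - int k + int k, - int k, 1)"
      by (simp add: fraction_matrix_def)
    show "fraction_matrix k (1, 1) = (int k + 2, 1 + int k, 1, 1)"
      by (simp only: fraction_matrix_one add.commute)
    show "1 * 1 - (int k + 2) * - int k = 1 + int k * (int k + 2)" by (simp add: algebra_simps)
  qed (auto simp: algebra_simps power2_eq_square)
  then show ?case by (simp add: farey_at_def markov_at_def numeral_2_eq_2)
next
  case (snoc d ds)
  obtain a1 b1 t a2 b2 where F: "farey_at (ToLeft # ds) = ((a1, b1), t, (a2, b2))"
    by (metis prod.exhaust)
  obtain m1 m m2 where M: "markov_at k (ToLeft # ds) = (m1, m, m2)" by (metis prod.exhaust)
  have det: "int b1 * int a2 - int a1 * int b2 = 1" and pos: "0 < b1" "0 < a2" "0 < b2"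
    and t: "t = (a1 + a2, b1 + b2)" and cop: "coprime m1 m" "coprime m m2"
    using snoc F M by auto
  obtain u1 w1 u w u2 w2 where mats: "fraction_matrix k (a1, b1) = (m1, u1 + int k, u1, w1)"
    "fraction_matrix k (a1 + a2, b1 + b2) = (m, u + int k, u, w)"
    "fraction_matrix k (a2, b2) = (m2, u2 + int k, u2, w2)"
    and rel: "m1 * u - m * u1 = m2 + int k * m" "m * u2 - m2 * u = m1 + int k * m2"
    using snoc F M by auto
  have mk: "m1 > 0" "m > 0" "m2 > 0"
    "m1\<^sup>2 + m\<^sup>2 + m2\<^sup>2 + int k * (m1 * m + m * m2 + m2 * m1) = (3 + 3 * int k) * m1 * m * m2"
    using markov_invariant[of k "ToLeft # ds"] M by auto
  have app: "farey_at (ToLeft # ds @ [d]) = farey_child d ((a1, b1), t, (a2, b2))"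
    "markov_at k (ToLeft # ds @ [d]) = markov_child k d (m1, m, m2)"
    using F M by (simp_all add: farey_at_def markov_at_def)
  show ?case
  proof (cases d)
    case ToLeft
    have "cohn_vertex k ((a1, b1), (a1 + (a1 + a2), b1 + (b1 + b2)), (a1 + a2, b1 + b2))
      (m1, (m1\<^sup>2 + int k * m1 * m + m\<^sup>2) div m2, m)"
      by (rule cohn_mediant[OF _ _ _ _ mats(1,2) rel(1) mk(4,1,2,3) cop(1)])
        (use det pos in \<open>auto simp: algebra_simps\<close>)
    then show ?thesis using app ToLeft t by simp
  next
    case ToRight
    have mk': "m\<^sup>2 + m2\<^sup>2 + m1\<^sup>2 + int k * (m * m2 + m2 * m1 + m1 * m) = (3 + 3 * int k) * m * m2 * m1"
      using mk(4) by (simp add: algebra_simps)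
    have "cohn_vertex k ((a1 + a2, b1 + b2), (a1 + a2 + a2, b1 + b2 + b2), (a2, b2))
      (m, (m\<^sup>2 + int k * m * m2 + m2\<^sup>2) div m1, m2)"
      by (rule cohn_mediant[OF _ _ _ _ mats(2,3) rel(2) mk' mk(2,3,1) cop(2)])
        (use det pos in \<open>auto simp: algebra_simps\<close>)
    then show ?thesis using app ToRight t by simp
  qed
qed

section \<open>Paths in the Farey tree\<close>

text \<open>Coefficients of the middle entry in terms of the two outer entries from which the path
  starts. They do not depend on those entries, and read from the front they are the subtractive
  Euclidean algorithm run backwards.\<close>

fun mid_coeffs :: "direction list \<Rightarrow> nat \<times> nat" where
  "mid_coeffs [] = (1, 1)"
| "mid_coeffs (ToLeft # ds) = (case mid_coeffs ds of (x, y) \<Rightarrow> (x + y, y))"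
| "mid_coeffs (ToRight # ds) = (case mid_coeffs ds of (x, y) \<Rightarrow> (x, x + y))"

lemma mid_coeffs_pos: "mid_coeffs ds = (x, y) \<Longrightarrow> 0 < x \<and> 0 < y"
  by (induction ds arbitrary: x y rule: mid_coeffs.induct) (auto split: prod.splits)

lemma fold_farey_child_mid:
  "mid_coeffs ds = (x, y) \<Longrightarrow>
   fst (snd (fold farey_child ds ((a, b), (a + e, b + f), (e, f)))) = (x * a + y * e, x * b + y * f)"
proof (induction ds arbitrary: a b e f x y)
  case (Cons d ds)
  obtain x' y' where xy: "mid_coeffs ds = (x', y')" by (cases "mid_coeffs ds")
  show ?case
  proof (cases d)
    case ToLeft
    then show ?thesis using Cons.IH[OF xy, of a b "a + e" "b + f"] Cons.prems xy
      by (auto simp: algebra_simps)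
  next
    case ToRight
    then show ?thesis using Cons.IH[OF xy, of "a + e" "b + f" e f] Cons.prems xy
      by (auto simp: algebra_simps)
  qed
qed auto

text \<open>The outer entries of the root are 0/1 and 1/0, so the second coefficient is the
  numerator.\<close>

lemma farey_at_mid: "fst (snd (farey_at ds)) = prod.swap (mid_coeffs ds)"
  using fold_farey_child_mid[of ds "fst (mid_coeffs ds)" "snd (mid_coeffs ds)" 0 1 1 0]
  by (simp add: farey_at_def prod.swap_def)

text \<open>Comparing the two coefficients reveals the first direction; they are equal only for the
  empty path.\<close>

lemma mid_coeffs_inject: "mid_coeffs ds = mid_coeffs es \<Longrightarrow> ds = es"
proof (induction ds arbitrary: es)
  case Nil
  then show ?case
    by (cases es rule: mid_coeffs.cases) (auto split: prod.splits dest: mid_coeffs_pos)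
next
  case (Cons d ds)
  then show ?case
    by (cases d; cases es rule: mid_coeffs.cases) (auto split: prod.splits dest: mid_coeffs_pos)
qed

lemma mid_coeffs_surj: "coprime x y \<Longrightarrow> 0 < x \<Longrightarrow> 0 < y \<Longrightarrow> \<exists>ds. mid_coeffs ds = (x, y)"
proof (induction "x + y" arbitrary: x y rule: less_induct)
  case less
  consider "x = y" | "x < y" | "y < x" by linarith
  then show ?case
  proof cases
    case 1
    then show ?thesis using less.prems by (intro exI[of _ "[]"]) auto
  next
    case 2
    then have "coprime x (y - x)" using less.prems gcd_diff1_nat[of x y] by (simp add: coprime_iff_gcd_eq_1 gcd.commute)
    then obtain ds where "mid_coeffs ds = (x, y - x)" using less.hyps[of x "y - x"] less.prems 2 by auto
    then show ?thesis using 2 by (intro exI[of _ "ToRight # ds"]) auto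
  next
    case 3
    then have "coprime (x - y) y" using less.prems by (simp add: coprime_iff_gcd_eq_1 gcd_diff1_nat)
    then obtain ds where "mid_coeffs ds = (x - y, y)" using less.hyps[of "x - y" y] less.prems 3 by auto
    then show ?thesis using 3 by (intro exI[of _ "ToLeft # ds"]) auto
  qed
qed

lemma farey_at_inject: "fst (snd (farey_at ds)) = fst (snd (farey_at es)) \<Longrightarrow> ds = es"
  unfolding farey_at_mid by (metis mid_coeffs_inject swap_swap)

lemma farey_path_exists:
  assumes "coprime a b" "0 < a" "a < b"
  obtains ds where "fst (snd (farey_at (ToLeft # ds))) = (a, b)"
proof -
  obtain ds where ds: "mid_coeffs ds = (b, a)"
    using mid_coeffs_surj[of b a] assms by (auto simp: coprime_commute)
  then obtain es where "ds = ToLeft # es"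
    using assms by (cases ds rule: mid_coeffs.cases) (auto split: prod.splits)
  then show ?thesis using that[of es] ds by (simp only: farey_at_mid swap_simp)
qed

lemma theta_farey_vertex:
  assumes "fst (snd (farey_at ds)) = t"
  shows "farey_vertex t = farey_at ds" and "theta k (farey_vertex t) = markov_at k ds"
proof -
  show v: "farey_vertex t = farey_at ds"
    unfolding farey_vertex_def farey_tree_def
    by (rule the_equality) (use assms in \<open>auto dest: farey_at_inject\<close>)
  have "(THE w. farey_at w = farey_at ds) = ds"
    by (rule the_equality) (use farey_at_inject in auto)
  then show "theta k (farey_vertex t) = markov_at k ds" by (simp add: theta_def v)
qed

section \<open>Values of the words as quotients by residues\<close>

lemma the_residue:
  fixes m c x y :: int
  assumes "coprime c m" "[c * x = y] (mod m)" "0 < x" "x < m"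
  shows "(THE z. 0 < z \<and> z < m \<and> [c * z = y] (mod m)) = x"
proof (rule the_equality)
  fix z assume z: "0 < z \<and> z < m \<and> [c * z = y] (mod m)"
  then have "[c * z = c * x] (mod m)" using assms(2) cong_sym cong_trans by blast
  then have "[z = x] (mod m)" using assms(1) by (simp add: cong_mult_lcancel)
  then show "z = x" using z assms by (simp add: cong_def)
qed (use assms in auto)

lemma fraction_words_values:
  fixes k a b :: nat
  assumes "coprime a b" "0 < a" "a < b"
  shows "cfrac_value (block_lengths (fraction_word Minus k (int b) (int a))) =
      real_of_int (m_mid k (a, b)) / real_of_int (v_plus k (a, b))"
    and "cfrac_value (block_lengths (fraction_word Plus k (int a) (int b))) =
      real_of_int (m_mid k (a, b)) / real_of_int (v_minus k (a, b))"
    and "cfrac_value (block_lengths (fraction_word Plus k (int b) (int a))) =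
      real_of_int (m_mid k (a, b)) / real_of_int (u_minus k (a, b))"
proof -
  obtain ds where ds: "fst (snd (farey_at (ToLeft # ds))) = (a, b)"
    using farey_path_exists[OF assms] .
  obtain m1 m m2 where M: "markov_at k (ToLeft # ds) = (m1, m, m2)" by (metis prod.exhaust)
  have th: "m_left k (a, b) = m1" "m_mid k (a, b) = m" "m_right k (a, b) = m2"
    by (simp_all add: m_left_def m_mid_def m_right_def theta_farey_vertex(2)[OF ds] M)
  obtain a1 b1 a2 b2 where F: "farey_at (ToLeft # ds) = ((a1, b1), (a, b), (a2, b2))"
    using ds by (metis prod.exhaust fst_conv snd_conv)
  obtain u1 u w u2 where mat: "fraction_matrix k (a, b) = (m, u + int k, u, w)"
    and rel: "m1 * u - m * u1 = m2 + int k * m" "m * u2 - m2 * u = m1 + int k * m2"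
    and cop: "coprime m1 m" "coprime m m2"
    using cohn_vertex_tree[of k ds] F M by auto
  have c: "coprime (int a) (int b)" "int a > 0" "int b > 0" using assms by auto
  obtain ws where ws: "fraction_word Minus k (int a) (int b) = Minus # ws @ [Plus]"
    and ws': "fraction_word Plus k (int b) (int a) = Minus # map flip ws @ [Plus]"
    using fraction_word_swap[OF c, of Minus k] by auto
  obtain xs where xs: "fraction_word Plus k (int a) (int b) = Minus # xs @ [Plus]"
    and xs': "fraction_word Minus k (int b) (int a) = Minus # map flip xs @ [Plus]"
    using fraction_word_swap[OF c, of Plus k] by auto
  have W: "word_matrix (Minus # ws @ [Plus]) = (m, u + int k, u, w)"
    using mat assms ws by (simp add: fraction_matrix_def)
  have X: "word_matrix (Minus # xs @ [Plus]) = (m, u, u + int k, w)"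
    using fraction_word_matrix_transpose[OF c, of k] xs ws W by simp
  \<comment> \<open>Exchanging the signs is conjugation by the permutation matrix, which reverses
    the quadruple of entries. With the outer \<open>Minus\<close> and \<open>Plus\<close> kept, p =
    e + f + g + h is unchanged while q = g + h becomes e + f.\<close>
  have flip_mat: "\<exists>v' w'. word_matrix (Minus # map flip zs @ [Plus]) = (p, v', p - q, w')"
    if "word_matrix (Minus # zs @ [Plus]) = (p, v, q, w)" for zs p v q w
  proof -
    obtain e f g h where z: "word_matrix zs = (e, f, g, h)" by (metis prod.exhaust)
    have "word_matrix (map flip zs) = (h, g, f, e)" using z
    proof (induction zs arbitrary: e f g h)
      case (Cons s zs)
      obtain e' f' g' h' where z': "word_matrix zs = (e', f', g', h')" by (metis prod.exhaust)
      show ?case using Cons.prems Cons.IH[OF z'] z' by (cases s) auto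
    qed auto
    then show ?thesis using that z by (auto simp: word_matrix_append)
  qed
  have bu: "0 < u" "u < m" using word_matrix_entries_bounds[OF W] by auto
  have bv: "0 < u + int k" "u + int k < m" using word_matrix_entries_bounds[OF X] by auto
  have um: "u_minus k (a, b) = m - u"
    unfolding u_minus_def th
  proof (rule the_residue)
    have "m1 * (m - u) - (- m2) = m * (m1 - u1 - int k)" using rel by algebra
    then show "[m1 * (m - u) = - m2] (mod m)" by (simp only: cong_iff_dvd_diff dvd_triv_left)
  qed (use bu cop in auto)
  have vm: "v_minus k (a, b) = u + int k"
    unfolding v_minus_def th
  proof (rule the_residue)
    have "m2 * (u + int k) - (- m1) = m * u2" using rel by algebra
    then show "[m2 * (u + int k) = - m1] (mod m)" by (simp only: cong_iff_dvd_diff dvd_triv_left)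
  qed (use bv cop in \<open>auto simp: coprime_commute\<close>)
  have vp: "v_plus k (a, b) = m - (u + int k)"
    unfolding v_plus_def th
  proof (rule the_residue)
    have "m2 * (m - (u + int k)) - m1 = m * (m2 - u2)" using rel by algebra
    then show "[m2 * (m - (u + int k)) = m1] (mod m)" by (simp only: cong_iff_dvd_diff dvd_triv_left)
  qed (use bv cop in \<open>auto simp: coprime_commute\<close>)
  show "cfrac_value (block_lengths (fraction_word Minus k (int b) (int a))) =
      real_of_int (m_mid k (a, b)) / real_of_int (v_plus k (a, b))"
    using flip_mat[OF X] cfrac_value_block_lengths unfolding xs' th vp by fastforce
  show "cfrac_value (block_lengths (fraction_word Plus k (int a) (int b))) =
      real_of_int (m_mid k (a, b)) / real_of_int (v_minus k (a, b))"
    using cfrac_value_block_lengths[OF X] unfolding xs th vm by simp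
  show "cfrac_value (block_lengths (fraction_word Plus k (int b) (int a))) =
      real_of_int (m_mid k (a, b)) / real_of_int (u_minus k (a, b))"
    using flip_mat[OF W] cfrac_value_block_lengths unfolding ws' th um by fastforce
qed

section \<open>Triangles cut by a line\<close>

definition height :: "nat \<Rightarrow> nat \<Rightarrow> point \<Rightarrow> real" where
  "height a b z = real b * snd z - real a * fst z"

lemma on_or_above_height: "on_or_above (a, b) = {z. 0 \<le> height a b z}"
  by (auto simp: height_def)

declare on_or_above.simps [simp del]

lemma height_combination3:
  "height a b (u *\<^sub>R p + v *\<^sub>R q + w *\<^sub>R r) = u * height a b p + v * height a b q + w * height a b r"
  by (simp add: height_def algebra_simps)

lemma height_combination2:
  "height a b (u *\<^sub>R p + v *\<^sub>R q) = u * height a b p + v * height a b q"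
  by (simp add: height_def algebra_simps)

lemma convex_above: "convex {z. 0 \<le> height a b z}"
  unfolding convex_def by (auto simp: height_combination2)

text \<open>The part above is the triangle cut off at \<open>p\<close>, so it has at most three
  extreme points. The weak inequalities admit vertices on the line, in which case \<open>x\<close>
  is \<open>q\<close> or \<open>y\<close> is \<open>r\<close>.\<close>

lemma not_quadrilateral_one_above:
  assumes "height a b p > 0" "height a b q \<le> 0" "height a b r \<le> 0"
  shows "\<not> quadrilateral (convex hull {p, q, r} \<inter> on_or_above (a, b))"
proof -
  define A where "A = height a b p"
  define B where "B = - height a b q"
  define C where "C = - height a b r"
  have pos: "A > 0" "B \<ge> 0" "C \<ge> 0" using assms by (auto simp: A_def B_def C_def)
  have height_vals: "height a b p = A" "height a b q = - B" "height a b r = - C"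
    by (simp_all add: A_def B_def C_def)
  have nz: "A \<noteq> 0" "A + B \<noteq> 0" "A + C \<noteq> 0" using pos by auto
  define x where "x = (B / (A + B)) *\<^sub>R p + (A / (A + B)) *\<^sub>R q"
  define y where "y = (C / (A + C)) *\<^sub>R p + (A / (A + C)) *\<^sub>R r"
  have "convex hull {p, q, r} \<inter> on_or_above (a, b) \<subseteq> convex hull {p, x, y}"
  proof
    fix z assume z: "z \<in> convex hull {p, q, r} \<inter> on_or_above (a, b)"
    then obtain u v w where uvw: "0 \<le> u" "0 \<le> v" "0 \<le> w" "u + v + w = 1"
      "z = u *\<^sub>R p + v *\<^sub>R q + w *\<^sub>R r" unfolding convex_hull_3 by auto
    have f: "u * A - v * B - w * C \<ge> 0"
      using z uvw(5) by (simp add: on_or_above_height height_combination3 A_def B_def C_def)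
    \<comment> \<open>Obtained by substituting q = ((A + B) / A) x - (B / A) p and the analogous
      expression for \<open>r\<close>.\<close>
    have "z = (u - v * B / A - w * C / A) *\<^sub>R p + (v * (A + B) / A) *\<^sub>R x + (w * (A + C) / A) *\<^sub>R y"
    proof -
      have "v * (A + B) / A * (B / (A + B)) = v * B / A" "v * (A + B) / A * (A / (A + B)) = v"
        "w * (A + C) / A * (C / (A + C)) = w * C / A" "w * (A + C) / A * (A / (A + C)) = w"
        using nz by simp_all
      then show ?thesis unfolding x_def y_def scaleR_add_right scaleR_scaleR uvw(5)
        by (simp add: scaleR_diff_left)
    qed
    moreover have "u - v * B / A - w * C / A \<ge> 0"
    proof -
      have "u - v * B / A - w * C / A = (u * A - v * B - w * C) / A" using pos by (simp add: field_simps)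
      then show ?thesis using f pos by simp
    qed
    moreover have "v * (A + B) / A \<ge> 0" "w * (A + C) / A \<ge> 0" using uvw pos by auto
    moreover have "(u - v * B / A - w * C / A) + v * (A + B) / A + w * (A + C) / A = 1"
    proof -
      have "v * (A + B) / A = v + v * B / A" "w * (A + C) / A = w + w * C / A"
        using pos by (simp_all add: field_simps)
      then show ?thesis using uvw(4) by simp
    qed
    ultimately show "z \<in> convex hull {p, x, y}" unfolding convex_hull_3 by blast
  qed
  moreover have "convex hull {p, x, y} \<subseteq> convex hull {p, q, r} \<inter> on_or_above (a, b)"
  proof (rule hull_minimal)
    have "x \<in> convex hull {p, q, r}" "y \<in> convex hull {p, q, r}"
      unfolding x_def y_def using pos
      by (intro convexD[OF convex_convex_hull];
          simp add: hull_inc add.commute flip: add_divide_distrib)+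
    moreover have "height a b x = 0" "height a b y = 0"
      by (simp_all add: x_def y_def height_combination2 height_vals)
    ultimately show "{p, x, y} \<subseteq> convex hull {p, q, r} \<inter> on_or_above (a, b)"
      using assms(1) by (auto simp: on_or_above_height hull_inc)
    show "convex (convex hull {p, q, r} \<inter> on_or_above (a, b))"
      unfolding on_or_above_height by (intro convex_Int convex_convex_hull convex_above)
  qed
  ultimately have S: "convex hull {p, q, r} \<inter> on_or_above (a, b) = convex hull {p, x, y}" by blast
  have "{z. z extreme_point_of convex hull {p, x, y}} \<subseteq> {p, x, y}"
    using extreme_point_of_convex_hull by blast
  then have "card {z. z extreme_point_of convex hull {p, x, y}} \<le> card {p, x, y}"
    by (intro card_mono) auto
  also have "\<dots> \<le> 3" by (simp add: card_insert_if)
  finally show ?thesis unfolding S quadrilateral_def by auto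
qed

text \<open>If nonnegative numbers have a convex combination with positive weights equal to 0, they
  all vanish; so both ends of a segment through \<open>x\<close> lie in the common zero set, which
  is \<open>x\<close> alone.\<close>

lemma extreme_point_by_two_functionals:
  fixes S :: "'a :: real_vector set"
  assumes "x \<in> S" "g x = 0" "h x = (0::real)"
    and "\<And>z. z \<in> S \<Longrightarrow> g z \<ge> 0" "\<And>z. z \<in> S \<Longrightarrow> h z \<ge> 0"
    and "\<And>u y z. g ((1 - u) *\<^sub>R y + u *\<^sub>R z) = (1 - u) * g y + u * (g z :: real)"
    and "\<And>u y z. h ((1 - u) *\<^sub>R y + u *\<^sub>R z) = (1 - u) * h y + u * h z"
    and "\<And>z. z \<in> S \<Longrightarrow> g z = 0 \<Longrightarrow> h z = 0 \<Longrightarrow> z = x"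
  shows "x extreme_point_of S"
  unfolding extreme_point_of_def
proof (intro conjI ballI notI)
  fix y z assume yz: "y \<in> S" "z \<in> S" "x \<in> open_segment y z"
  then obtain u where u: "0 < u" "u < 1" "x = (1 - u) *\<^sub>R y + u *\<^sub>R z" "y \<noteq> z"
    unfolding in_segment by auto
  have "(1 - u) * g y + u * g z = 0" "(1 - u) * h y + u * h z = 0"
    using u(3) assms(2,3,6,7) by metis+
  moreover have "(1 - u) * g y \<ge> 0" "u * g z \<ge> 0" "(1 - u) * h y \<ge> 0" "u * h z \<ge> 0"
    using assms(4,5) yz u by auto
  ultimately have "(1 - u) * g y = 0" "u * g z = 0" "(1 - u) * h y = 0" "u * h z = 0" by linarith+
  then have "g y = 0" "g z = 0" "h y = 0" "h z = 0" using u by auto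
  then have "y = x" "z = x" using assms(8) yz(1,2) by blast+
  then show False using u(4) by simp
qed (rule assms(1))

text \<open>The functions \<open>gp\<close>, \<open>gq\<close>, \<open>gr\<close> are the barycentric coordinates of the triangle.\<close>

lemma quadrilateral_two_above:
  fixes gp gq gr :: "point \<Rightarrow> real"
  assumes above: "height a b p > 0" "height a b q > 0" "height a b r < 0"
    and rep: "\<And>z. z = gp z *\<^sub>R p + gq z *\<^sub>R q + gr z *\<^sub>R r" "\<And>z. gp z + gq z + gr z = 1"
    and bary: "\<And>u v. gp (u *\<^sub>R p + v *\<^sub>R q + (1 - u - v) *\<^sub>R r) = u"
      "\<And>u v. gq (u *\<^sub>R p + v *\<^sub>R q + (1 - u - v) *\<^sub>R r) = v"
    and affine: "\<And>u y z. gp ((1 - u) *\<^sub>R y + u *\<^sub>R z) = (1 - u) * gp y + u * gp z"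
      "\<And>u y z. gq ((1 - u) *\<^sub>R y + u *\<^sub>R z) = (1 - u) * gq y + u * gq z"
      "\<And>u y z. gr ((1 - u) *\<^sub>R y + u *\<^sub>R z) = (1 - u) * gr y + u * gr z"
  shows "quadrilateral (convex hull {p, q, r} \<inter> on_or_above (a, b))" (is "quadrilateral ?S")
proof -
  have coords: "gp (u *\<^sub>R p + v *\<^sub>R q + w *\<^sub>R r) = u" "gq (u *\<^sub>R p + v *\<^sub>R q + w *\<^sub>R r) = v"
    "gr (u *\<^sub>R p + v *\<^sub>R q + w *\<^sub>R r) = w" if "u + v + w = 1" for u v w
  proof -
    have w: "w = 1 - u - v" using that by simp
    show "gp (u *\<^sub>R p + v *\<^sub>R q + w *\<^sub>R r) = u" "gq (u *\<^sub>R p + v *\<^sub>R q + w *\<^sub>R r) = v"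
      unfolding w by (fact bary)+
    then show "gr (u *\<^sub>R p + v *\<^sub>R q + w *\<^sub>R r) = w"
      using rep(2)[of "u *\<^sub>R p + v *\<^sub>R q + w *\<^sub>R r"] that by simp
  qed
  define A where "A = height a b p"
  define B where "B = height a b q"
  define C where "C = - height a b r"
  have pos: "A > 0" "B > 0" "C > 0" using above by (auto simp: A_def B_def C_def)
  define x where "x = (C / (A + C)) *\<^sub>R p + (A / (A + C)) *\<^sub>R r"
  define y where "y = (C / (B + C)) *\<^sub>R q + (B / (B + C)) *\<^sub>R r"
  have height_coords: "height a b z = gp z * A + gq z * B - gr z * C" for z
    using height_combination3[of a b "gp z" p "gq z" q "gr z" r] rep(1)[of z]
    by (simp add: A_def B_def C_def)
  have S: "?S = {z. gp z \<ge> 0 \<and> gq z \<ge> 0 \<and> gr z \<ge> 0 \<and> height a b z \<ge> 0}"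
  proof -
    have "z \<in> convex hull {p, q, r} \<longleftrightarrow> gp z \<ge> 0 \<and> gq z \<ge> 0 \<and> gr z \<ge> 0" for z
    proof
      assume "z \<in> convex hull {p, q, r}"
      then show "gp z \<ge> 0 \<and> gq z \<ge> 0 \<and> gr z \<ge> 0"
        unfolding convex_hull_3 using coords by auto
    next
      assume "gp z \<ge> 0 \<and> gq z \<ge> 0 \<and> gr z \<ge> 0"
      then show "z \<in> convex hull {p, q, r}" unfolding convex_hull_3 using rep by blast
    qed
    then show ?thesis by (auto simp: on_or_above_height)
  qed
  have gP: "gp p = 1" "gq p = 0" "gr p = 0"
    using coords[of 1 0 0] by auto
  have gQ: "gp q = 0" "gq q = 1" "gr q = 0"
    using coords[of 0 1 0] by auto
  have gX: "gp x = C / (A + C)" "gq x = 0" "gr x = A / (A + C)"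
    using coords[of "C / (A + C)" 0 "A / (A + C)"] pos
    by (simp_all add: x_def add.commute flip: add_divide_distrib)
  have gY: "gp y = 0" "gq y = C / (B + C)" "gr y = B / (B + C)"
    using coords[of 0 "C / (B + C)" "B / (B + C)"] pos
    by (simp_all add: y_def add.commute flip: add_divide_distrib)
  have hX: "height a b x = 0" and hY: "height a b y = 0"
    by (simp_all add: height_coords gX gY)
  have mem: "p \<in> ?S" "q \<in> ?S" "x \<in> ?S" "y \<in> ?S"
    unfolding S using gP gQ gX gY hX hY above pos by auto
  have h_affine: "height a b ((1 - u) *\<^sub>R y + u *\<^sub>R z) = (1 - u) * height a b y + u * height a b z" for u y z
    by (rule height_combination2)
  have eP: "p extreme_point_of ?S"
  proof (rule extreme_point_by_two_functionals[OF mem(1) gP(2,3) _ _ affine(2,3)])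
    fix z assume "gq z = 0" "gr z = 0"
    then show "z = p" using rep[of z] by simp
  qed (auto simp: S)
  have eQ: "q extreme_point_of ?S"
  proof (rule extreme_point_by_two_functionals[OF mem(2) gQ(1,3) _ _ affine(1,3)])
    fix z assume "gp z = 0" "gr z = 0"
    then show "z = q" using rep[of z] by simp
  qed (auto simp: S)
  have eX: "x extreme_point_of ?S"
  proof (rule extreme_point_by_two_functionals[OF mem(3) gX(2) hX _ _ affine(2) h_affine])
    fix z assume z: "gq z = 0" "height a b z = 0"
    then have "gp z * A = gr z * C" "gp z = 1 - gr z" using rep(2)[of z] by (auto simp: height_coords)
    then have "gr z * (A + C) = A" "gp z * (A + C) = C" by algebra+
    then have "gr z = A / (A + C)" "gp z = C / (A + C)" using pos by (auto simp: eq_divide_eq)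
    then show "z = x" using rep(1)[of z] z by (simp add: x_def)
  qed (auto simp: S)
  have eY: "y extreme_point_of ?S"
  proof (rule extreme_point_by_two_functionals[OF mem(4) gY(1) hY _ _ affine(1) h_affine])
    fix z assume z: "gp z = 0" "height a b z = 0"
    then have "gq z * B = gr z * C" "gq z = 1 - gr z" using rep(2)[of z] by (auto simp: height_coords)
    then have "gr z * (B + C) = B" "gq z * (B + C) = C" by algebra+
    then have "gr z = B / (B + C)" "gq z = C / (B + C)" using pos by (auto simp: eq_divide_eq)
    then show "z = y" using rep(1)[of z] z by (simp add: y_def)
  qed (auto simp: S)
  have hull: "?S = convex hull {p, q, x, y}"
  proof
    show "convex hull {p, q, x, y} \<subseteq> ?S"
    proof (rule hull_minimal)
      show "convex ?S" unfolding on_or_above_height by (intro convex_Int convex_convex_hull convex_above)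
    qed (use mem in auto)
    show "?S \<subseteq> convex hull {p, q, x, y}"
    proof
      fix z assume "z \<in> ?S"
      then have g: "gp z \<ge> 0" "gq z \<ge> 0" "gr z \<ge> 0" "gp z * A + gq z * B - gr z * C \<ge> 0"
        unfolding S by (auto simp: height_coords)
      define D where "D = gp z * A + gq z * B"
      have "D > 0"
      proof (rule ccontr)
        assume "\<not> D > 0"
        moreover have "gp z * A \<ge> 0" "gq z * B \<ge> 0" "gr z * C \<ge> 0" using g pos by auto
        ultimately have "gp z * A = 0" "gq z * B = 0" "gr z * C = 0" using g D_def by linarith+
        then show False using rep(2)[of z] pos by simp
      qed
      \<comment> \<open>The weight of \<open>r\<close> is shared between \<open>x\<close> and
        \<open>y\<close> in the proportion \<open>gp z * A\<close> to \<open>gq z * B\<close>, the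
        heights contributed by \<open>p\<close> and \<open>q\<close>. This leaves nonnegative
        weights for \<open>p\<close> and \<open>q\<close> because
        \<open>gr z * C \<le> D\<close>.\<close>
      define s where "s = gr z * (A + C) * gp z / D"
      define t where "t = gr z * (B + C) * gq z / D"
      define u where "u = gp z - s * (C / (A + C))"
      define v where "v = gq z - t * (C / (B + C))"
      have u: "u = gp z * (1 - gr z * C / D)" and v: "v = gq z * (1 - gr z * C / D)"
      proof -
        have "s * (C / (A + C)) = gp z * (gr z * C / D)" "t * (C / (B + C)) = gq z * (gr z * C / D)"
          using pos by (simp_all add: s_def t_def)
        then show "u = gp z * (1 - gr z * C / D)" "v = gq z * (1 - gr z * C / D)"
          by (simp_all add: u_def v_def right_diff_distrib)
      qed
      have "gr z * C / D \<le> 1" using g \<open>D > 0\<close> by (simp add: D_def)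
      then have nn: "u \<ge> 0" "v \<ge> 0" "s \<ge> 0" "t \<ge> 0"
        using g pos \<open>D > 0\<close> unfolding u v s_def t_def by auto
      have st: "s * (A / (A + C)) + t * (B / (B + C)) = gr z"
      proof -
        have "s * (A / (A + C)) = gr z * (gp z * A) / D" "t * (B / (B + C)) = gr z * (gq z * B) / D"
          using pos by (simp_all add: s_def t_def)
        then have "s * (A / (A + C)) + t * (B / (B + C)) = gr z * (gp z * A + gq z * B) / D"
          by (simp add: distrib_left add_divide_distrib)
        then show ?thesis using \<open>D > 0\<close> by (simp add: D_def)
      qed
      have sum: "u + v + s + t = 1"
      proof -
        have "s = s * (C / (A + C)) + s * (A / (A + C))" "t = t * (C / (B + C)) + t * (B / (B + C))"
        proof -
          have "C / (A + C) + A / (A + C) = 1" "C / (B + C) + B / (B + C) = 1"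
            using pos by (simp_all add: add.commute flip: add_divide_distrib)
          then show "s = s * (C / (A + C)) + s * (A / (A + C))" "t = t * (C / (B + C)) + t * (B / (B + C))"
            by (metis distrib_left mult_1_right)+
        qed
        then show ?thesis using st rep(2)[of z] unfolding u_def v_def by linarith
      qed
      have "u *\<^sub>R p + v *\<^sub>R q + s *\<^sub>R x + t *\<^sub>R y =
          (u + s * (C / (A + C))) *\<^sub>R p + (v + t * (C / (B + C))) *\<^sub>R q +
          (s * (A / (A + C)) + t * (B / (B + C))) *\<^sub>R r"
        unfolding x_def y_def scaleR_add_right scaleR_scaleR scaleR_add_left by simp
      also have "\<dots> = gp z *\<^sub>R p + gq z *\<^sub>R q + gr z *\<^sub>R r" unfolding st by (simp add: u_def v_def)
      also have "\<dots> = z" using rep(1)[of z] by simp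
      finally have z: "z = u *\<^sub>R p + v *\<^sub>R q + s *\<^sub>R x + t *\<^sub>R y" ..
      have "(\<Sum>i\<in>{0,1,2,3::nat}. [u, v, s, t] ! i *\<^sub>R [p, q, x, y] ! i) \<in> convex hull {p, q, x, y}"
      proof (rule convex_sum[OF _ convex_convex_hull])
        show "sum ((!) [u, v, s, t]) {0, 1, 2, 3} = 1" using sum by simp
      qed (use nn in \<open>auto simp: hull_inc numeral_3_eq_3 numeral_2_eq_2\<close>)
      then show "z \<in> convex hull {p, q, x, y}"
        unfolding z by (simp add: numeral_3_eq_3 numeral_2_eq_2 add.assoc)
    qed
  qed
  have "{z. z extreme_point_of ?S} = {p, q, x, y}"
  proof
    show "{z. z extreme_point_of ?S} \<subseteq> {p, q, x, y}"
      using extreme_point_of_convex_hull unfolding hull by blast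
  qed (simp add: eP eQ eX eY)
  moreover have "card {p, q, x, y} = 4"
  proof -
    have "p \<noteq> q" using gP(1) gQ(1) by auto
    moreover have "p \<noteq> x" using gP(3) gX(3) pos by auto
    moreover have "p \<noteq> y" using gP(1) gY(1) by auto
    moreover have "q \<noteq> x" using gQ(2) gX(2) by auto
    moreover have "q \<noteq> y" using gQ(3) gY(3) pos by auto
    moreover have "x \<noteq> y" using gX(2) gY(2) pos by auto
    ultimately show ?thesis by simp
  qed
  moreover have "polytope ?S" unfolding hull by (simp add: polytope_convex_hull)
  moreover have "aff_dim ?S = 2"
  proof -
    have "z \<in> affine hull ?S" for z
    proof -
      \<comment> \<open>The vertex \<open>r\<close> lies on the line through \<open>p\<close> and
        \<open>x\<close>, so the part above the line already spans the plane.\<close>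
      have r: "r = ((A + C) / A) *\<^sub>R x - (C / A) *\<^sub>R p"
        using pos by (simp add: x_def scaleR_add_right)
      have "(gp z - gr z * (C / A)) *\<^sub>R p + gq z *\<^sub>R q + (gr z * ((A + C) / A)) *\<^sub>R x \<in> affine hull ?S"
      proof (rule mem_affine_3[OF affine_affine_hull])
        have "gr z * ((A + C) / A) = gr z + gr z * (C / A)" using pos by (simp add: field_simps)
        then show "gp z - gr z * (C / A) + gq z + gr z * ((A + C) / A) = 1" using rep(2)[of z] by simp
      qed (use mem in \<open>auto simp: hull_inc\<close>)
      also have "(gp z - gr z * (C / A)) *\<^sub>R p + gq z *\<^sub>R q + (gr z * ((A + C) / A)) *\<^sub>R x =
          gp z *\<^sub>R p + gq z *\<^sub>R q + gr z *\<^sub>R r"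
        unfolding r by (simp add: scaleR_diff_left scaleR_diff_right)
      finally show ?thesis using rep(1)[of z] by simp
    qed
    then have "affine hull ?S = UNIV" by blast
    then have "aff_dim ?S = aff_dim (UNIV :: point set)" by (metis aff_dim_affine_hull)
    then show ?thesis by simp
  qed
  ultimately show ?thesis by (simp add: quadrilateral_def)
qed


section \<open>The cells met by the segment\<close>

abbreviation lattice_point :: "int \<Rightarrow> int \<Rightarrow> point" where
  "lattice_point i j \<equiv> (real_of_int i, real_of_int j)"

definition lower_triangle :: "int \<Rightarrow> int \<Rightarrow> cell" where
  "lower_triangle i j = Triangle (lattice_point i j) (lattice_point (i + 1) j) (lattice_point i (j + 1))"

definition upper_triangle :: "int \<Rightarrow> int \<Rightarrow> cell" where
  "upper_triangle i j =
     Triangle (lattice_point (i + 1) j) (lattice_point i (j + 1)) (lattice_point (i + 1) (j + 1))"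

definition diagonal :: "int \<Rightarrow> int \<Rightarrow> cell" where
  "diagonal i j = Edge (lattice_point i (j + 1)) (lattice_point (i + 1) j)"

definition horizontal_side :: "int \<Rightarrow> int \<Rightarrow> cell" where
  "horizontal_side i j = Edge (lattice_point i j) (lattice_point (i + 1) j)"

definition vertical_side :: "int \<Rightarrow> int \<Rightarrow> cell" where
  "vertical_side i j = Edge (lattice_point i j) (lattice_point i (j + 1))"

lemma square_cells_eq:
  "square_cells i j = {lower_triangle i j, upper_triangle i j, diagonal i j, horizontal_side i j,
     horizontal_side i (j + 1), vertical_side i j, vertical_side (i + 1) j}"
  by (simp add: square_cells_def lower_triangle_def upper_triangle_def diagonal_def
      horizontal_side_def vertical_side_def Let_def)

text \<open>Eliminates the parameter of a segment: along every side and diagonal one coordinate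
  advances by exactly that parameter.\<close>

lemma ex_unit_shift:
  fixes x c :: real
  shows "(\<exists>s. 0 \<le> s \<and> s \<le> 1 \<and> x = c + s \<and> P) \<longleftrightarrow> c \<le> x \<and> x \<le> c + 1 \<and> P"
    and "(\<exists>s. 0 < s \<and> s < 1 \<and> x = c + s \<and> P) \<longleftrightarrow> c < x \<and> x < c + 1 \<and> P"
  by (force intro: exI[of _ "x - c"])+

lemma region_lower_triangle:
  "region (lower_triangle i j) =
   {z. real_of_int i \<le> fst z \<and> real_of_int j \<le> snd z \<and> fst z + snd z \<le> real_of_int (i + j + 1)}"
  (is "_ = ?S")
proof
  show "region (lower_triangle i j) \<subseteq> ?S"
  proof
    fix z assume "z \<in> region (lower_triangle i j)"
    then obtain u v w where uvw: "0 \<le> u" "0 \<le> v" "0 \<le> w" "u + v + w = 1"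
      "z = u *\<^sub>R lattice_point i j + v *\<^sub>R lattice_point (i + 1) j + w *\<^sub>R lattice_point i (j + 1)"
      unfolding lower_triangle_def region.simps convex_hull_3 by auto
    have u: "u = 1 - v - w" using uvw(4) by simp
    have "z = (real_of_int i + v, real_of_int j + w)"
      unfolding uvw(5) u by (simp add: algebra_simps)
    then show "z \<in> ?S" using uvw by auto
  qed
  show "?S \<subseteq> region (lower_triangle i j)"
  proof
    fix z assume z: "z \<in> ?S"
    let ?v = "fst z - real_of_int i" and ?w = "snd z - real_of_int j"
    have "z = (1 - ?v - ?w) *\<^sub>R lattice_point i j + ?v *\<^sub>R lattice_point (i + 1) j + ?w *\<^sub>R lattice_point i (j + 1)"
      by (cases z) (simp add: algebra_simps)
    moreover have "0 \<le> 1 - ?v - ?w" "0 \<le> ?v" "0 \<le> ?w" using z by auto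
    ultimately show "z \<in> region (lower_triangle i j)"
      unfolding lower_triangle_def region.simps convex_hull_3 by fastforce
  qed
qed

lemma region_upper_triangle:
  "region (upper_triangle i j) =
   {z. fst z \<le> real_of_int (i + 1) \<and> snd z \<le> real_of_int (j + 1) \<and> real_of_int (i + j + 1) \<le> fst z + snd z}"
  (is "_ = ?S")
proof
  show "region (upper_triangle i j) \<subseteq> ?S"
  proof
    fix z assume "z \<in> region (upper_triangle i j)"
    then obtain u v w where uvw: "0 \<le> u" "0 \<le> v" "0 \<le> w" "u + v + w = 1"
      "z = u *\<^sub>R lattice_point (i + 1) j + v *\<^sub>R lattice_point i (j + 1) + w *\<^sub>R lattice_point (i + 1) (j + 1)"
      unfolding upper_triangle_def region.simps convex_hull_3 by auto
    have w: "w = 1 - u - v" using uvw(4) by simp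
    have "z = (real_of_int i + 1 - v, real_of_int j + 1 - u)"
      unfolding uvw(5) w by (simp add: algebra_simps)
    then show "z \<in> ?S" using uvw by auto
  qed
  show "?S \<subseteq> region (upper_triangle i j)"
  proof
    fix z assume z: "z \<in> ?S"
    let ?u = "real_of_int j + 1 - snd z" and ?v = "real_of_int i + 1 - fst z"
    have "z = ?u *\<^sub>R lattice_point (i + 1) j + ?v *\<^sub>R lattice_point i (j + 1) +
        (1 - ?u - ?v) *\<^sub>R lattice_point (i + 1) (j + 1)"
      by (cases z) (simp add: algebra_simps)
    moreover have "0 \<le> ?u" "0 \<le> ?v" "0 \<le> 1 - ?u - ?v" using z by auto
    ultimately show "z \<in> region (upper_triangle i j)"
      unfolding upper_triangle_def region.simps convex_hull_3 by fastforce
  qed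
qed

lemma interior_lower_triangle:
  "interior (region (lower_triangle i j)) =
   {z. real_of_int i < fst z \<and> real_of_int j < snd z \<and> fst z + snd z < real_of_int (i + j + 1)}"
proof -
  have "region (lower_triangle i j) =
    {z. (1, 0) \<bullet> z \<ge> real_of_int i} \<inter> {z. (0, 1) \<bullet> z \<ge> real_of_int j} \<inter>
    {z. (1, 1) \<bullet> z \<le> real_of_int (i + j + 1)}"
    unfolding region_lower_triangle by (auto simp: inner_prod_def)
  then have "interior (region (lower_triangle i j)) =
    {z. (1, 0) \<bullet> z > real_of_int i} \<inter> {z. (0, 1) \<bullet> z > real_of_int j} \<inter>
    {z. (1, 1) \<bullet> z < real_of_int (i + j + 1)}"
    by (simp add: interior_Int zero_prod_def del: region.simps)
  then show ?thesis by (auto simp: inner_prod_def)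
qed

lemma interior_upper_triangle:
  "interior (region (upper_triangle i j)) =
   {z. fst z < real_of_int (i + 1) \<and> snd z < real_of_int (j + 1) \<and> real_of_int (i + j + 1) < fst z + snd z}"
proof -
  have "region (upper_triangle i j) =
    {z. (1, 0) \<bullet> z \<le> real_of_int (i + 1)} \<inter> {z. (0, 1) \<bullet> z \<le> real_of_int (j + 1)} \<inter>
    {z. (1, 1) \<bullet> z \<ge> real_of_int (i + j + 1)}"
    unfolding region_upper_triangle by (auto simp: inner_prod_def)
  then have "interior (region (upper_triangle i j)) =
    {z. (1, 0) \<bullet> z < real_of_int (i + 1)} \<inter> {z. (0, 1) \<bullet> z < real_of_int (j + 1)} \<inter>
    {z. (1, 1) \<bullet> z > real_of_int (i + j + 1)}"
    by (simp add: interior_Int zero_prod_def del: region.simps)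
  then show ?thesis by (auto simp: inner_prod_def)
qed

lemma rel_interior_lower_triangle:
  "rel_interior (region (lower_triangle i j)) =
   {z. real_of_int i < fst z \<and> real_of_int j < snd z \<and> fst z + snd z < real_of_int (i + j + 1)}"
proof -
  have "(real_of_int i + 1/4, real_of_int j + 1/4) \<in> interior (region (lower_triangle i j))"
    by (simp add: interior_lower_triangle)
  then show ?thesis using rel_interior_nonempty_interior interior_lower_triangle by blast
qed

lemma rel_interior_upper_triangle:
  "rel_interior (region (upper_triangle i j)) =
   {z. fst z < real_of_int (i + 1) \<and> snd z < real_of_int (j + 1) \<and> real_of_int (i + j + 1) < fst z + snd z}"
proof -
  have "(real_of_int i + 3/4, real_of_int j + 3/4) \<in> interior (region (upper_triangle i j))"
    by (simp add: interior_upper_triangle)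
  then show ?thesis using rel_interior_nonempty_interior interior_upper_triangle by blast
qed

lemma rel_interior_diagonal:
  "rel_interior (region (diagonal i j)) =
   {z. real_of_int i < fst z \<and> fst z < real_of_int (i + 1) \<and> fst z + snd z = real_of_int (i + j + 1)}"
proof -
  have "z \<in> open_segment (lattice_point i (j + 1)) (lattice_point (i + 1) j) \<longleftrightarrow>
    real_of_int i < fst z \<and> fst z < real_of_int (i + 1) \<and> fst z + snd z = real_of_int (i + j + 1)" for z
  proof -
    have "z = (1 - s) *\<^sub>R (lattice_point i (j + 1)) + s *\<^sub>R (lattice_point (i + 1) j) \<longleftrightarrow>
      fst z = real_of_int i + s \<and> fst z + snd z = real_of_int (i + j + 1)" for s
      by (cases z) (auto simp: algebra_simps)
    then show ?thesis by (simp only: in_segment ex_unit_shift) auto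
  qed
  then show ?thesis by (auto simp: diagonal_def rel_interior_closed_segment)
qed

lemma rel_interior_horizontal_side:
  "rel_interior (region (horizontal_side i j)) =
   {z. real_of_int i < fst z \<and> fst z < real_of_int (i + 1) \<and> snd z = real_of_int j}"
proof -
  have "z \<in> open_segment (lattice_point i j) (lattice_point (i + 1) j) \<longleftrightarrow>
    real_of_int i < fst z \<and> fst z < real_of_int (i + 1) \<and> snd z = real_of_int j" for z
  proof -
    have "z = (1 - s) *\<^sub>R (lattice_point i j) + s *\<^sub>R (lattice_point (i + 1) j) \<longleftrightarrow>
      fst z = real_of_int i + s \<and> snd z = real_of_int j" for s
      by (cases z) (auto simp: algebra_simps)
    then show ?thesis by (simp only: in_segment ex_unit_shift) auto
  qed
  then show ?thesis by (auto simp: horizontal_side_def rel_interior_closed_segment)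
qed

lemma rel_interior_vertical_side:
  "rel_interior (region (vertical_side i j)) =
   {z. fst z = real_of_int i \<and> real_of_int j < snd z \<and> snd z < real_of_int (j + 1)}"
proof -
  have "z \<in> open_segment (lattice_point i j) (lattice_point i (j + 1)) \<longleftrightarrow>
    fst z = real_of_int i \<and> real_of_int j < snd z \<and> snd z < real_of_int (j + 1)" for z
  proof -
    have "z = (1 - s) *\<^sub>R (lattice_point i j) + s *\<^sub>R (lattice_point i (j + 1)) \<longleftrightarrow>
      snd z = real_of_int j + s \<and> fst z = real_of_int i" for s
      by (cases z) (auto simp: algebra_simps)
    then show ?thesis by (simp only: in_segment ex_unit_shift) auto
  qed
  then show ?thesis by (auto simp: vertical_side_def rel_interior_closed_segment)
qed

lemma region_horizontal_side:
  "region (horizontal_side i j) =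
   {z. real_of_int i \<le> fst z \<and> fst z \<le> real_of_int (i + 1) \<and> snd z = real_of_int j}"
proof -
  have "z \<in> closed_segment (lattice_point i j) (lattice_point (i + 1) j) \<longleftrightarrow>
    real_of_int i \<le> fst z \<and> fst z \<le> real_of_int (i + 1) \<and> snd z = real_of_int j" for z
  proof -
    have "z = (1 - s) *\<^sub>R (lattice_point i j) + s *\<^sub>R (lattice_point (i + 1) j) \<longleftrightarrow>
      fst z = real_of_int i + s \<and> snd z = real_of_int j" for s
      by (cases z) (auto simp: algebra_simps)
    then show ?thesis by (simp only: in_segment ex_unit_shift) auto
  qed
  then show ?thesis by (auto simp: horizontal_side_def)
qed

lemma region_vertical_side:
  "region (vertical_side i j) =
   {z. fst z = real_of_int i \<and> real_of_int j \<le> snd z \<and> snd z \<le> real_of_int (j + 1)}"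
proof -
  have "z \<in> closed_segment (lattice_point i j) (lattice_point i (j + 1)) \<longleftrightarrow>
    fst z = real_of_int i \<and> real_of_int j \<le> snd z \<and> snd z \<le> real_of_int (j + 1)" for z
  proof -
    have "z = (1 - s) *\<^sub>R (lattice_point i j) + s *\<^sub>R (lattice_point i (j + 1)) \<longleftrightarrow>
      snd z = real_of_int j + s \<and> fst z = real_of_int i" for s
      by (cases z) (auto simp: algebra_simps)
    then show ?thesis by (simp only: in_segment ex_unit_shift) auto
  qed
  then show ?thesis by (auto simp: vertical_side_def)
qed

lemma region_diagonal:
  "region (diagonal i j) =
   {z. real_of_int i \<le> fst z \<and> fst z \<le> real_of_int (i + 1) \<and> fst z + snd z = real_of_int (i + j + 1)}"
proof -
  have "z \<in> closed_segment (lattice_point i (j + 1)) (lattice_point (i + 1) j) \<longleftrightarrow>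
    real_of_int i \<le> fst z \<and> fst z \<le> real_of_int (i + 1) \<and> fst z + snd z = real_of_int (i + j + 1)" for z
  proof -
    have "z = (1 - s) *\<^sub>R (lattice_point i (j + 1)) + s *\<^sub>R (lattice_point (i + 1) j) \<longleftrightarrow>
      fst z = real_of_int i + s \<and> fst z + snd z = real_of_int (i + j + 1)" for s
      by (cases z) (auto simp: algebra_simps)
    then show ?thesis by (simp only: in_segment ex_unit_shift) auto
  qed
  then show ?thesis by (auto simp: diagonal_def)
qed

text \<open>The heads agree, since otherwise each would precede the other.\<close>

lemma sorted_wrt_distinct_unique:
  assumes "sorted_wrt P xs" "sorted_wrt P ys" "distinct xs" "distinct ys" "set xs = set ys"
    and "\<And>x y. x \<in> set xs \<Longrightarrow> y \<in> set xs \<Longrightarrow> P x y \<Longrightarrow> \<not> P y x"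
  shows "xs = ys"
  using assms
proof (induction xs arbitrary: ys)
  case (Cons x xs)
  obtain y ys' where ys: "ys = y # ys'" using Cons.prems(5) by (cases ys) auto
  have "x = y"
  proof (rule ccontr)
    assume "x \<noteq> y"
    then have "x \<in> set ys'" "y \<in> set xs" using Cons.prems(5) ys by auto
    then have "P y x" "P x y" using Cons.prems(1,2) ys by auto
    then show False using Cons.prems(6)[of x y] \<open>y \<in> set xs\<close> by simp
  qed
  moreover have "xs = ys'"
  proof (rule Cons.IH)
    show "set xs = set ys'" using Cons.prems(3-5) ys \<open>x = y\<close> by auto
    show "\<not> P w z" if "z \<in> set xs" "w \<in> set xs" "P z w" for z w
      using Cons.prems(6) that by simp
  qed (use Cons.prems(1-4) ys in auto)
  ultimately show ?case by (simp add: ys)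
qed simp

declare seg_end.simps [simp del]

section \<open>Numbering the squares and ordering the cells\<close>

locale fraction_segment =
  fixes a b :: nat
  assumes coprime: "coprime a b" and a_pos: "0 < a" and b_pos: "0 < b"
begin

lemma coprime_int: "coprime (int a) (int b)" "int a > 0" "int b > 0"
  using coprime a_pos b_pos by auto

abbreviation "lv \<equiv> level (int a) (int b)"
abbreviation "segment \<equiv> closed_segment (0, 0) (seg_end (a, b))"

text \<open>For x + y = n, b (n + 1) - (a + b) x is the level plus b, a remainder modulo a + b; so
  the quotient is the abscissa of the lower left corner.\<close>

definition col :: "nat \<Rightarrow> int" where
  "col n = int b * (int n + 1) div (int a + int b)"

definition row :: "nat \<Rightarrow> int" where
  "row n = int n - col n"

lemma level_square: "lv n = int b * row n - int a * col n"
proof -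
  have "int b * (int n + 1) mod (int a + int b) = int b * (int n + 1) - (int a + int b) * col n"
    by (simp add: col_def minus_mult_div_eq_mod)
  then show ?thesis by (simp add: level_def row_def algebra_simps)
qed

lemma square_bounds:
  assumes "n + 1 < a + b"
  shows "0 \<le> col n" "col n + 1 \<le> int b" "0 \<le> row n" "row n + 1 \<le> int a"
    "int b * row n < int a * (col n + 1)" "int a * col n < int b * (row n + 1)"
proof -
  have lv: "- int b < lv n" "lv n < int a"
    using level_bounds[OF coprime_int(1), of n] assms by auto
  show 1: "int b * row n < int a * (col n + 1)" and 2: "int a * col n < int b * (row n + 1)"
    using lv by (simp_all add: level_square algebra_simps)
  show c: "0 \<le> col n" unfolding col_def using a_pos by (intro pos_imp_zdiv_nonneg_iff[THEN iffD2]) auto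
  then have "0 < int b * (row n + 1)" using 2 by (simp add: order_le_less_trans[OF _ 2])
  then show "0 \<le> row n" using b_pos by (simp add: zero_less_mult_iff)
  have "int b * (int n + 1) < int b * (int a + int b)"
    using assms b_pos by (intro mult_strict_left_mono) auto
  moreover have "(int a + int b) * col n + int b * (int n + 1) mod (int a + int b) = int b * (int n + 1)"
    unfolding col_def by (rule mult_div_mod_eq)
  moreover have "int b * (int n + 1) mod (int a + int b) \<ge> 0" using a_pos by simp
  ultimately have "(int a + int b) * col n < (int a + int b) * int b"
    unfolding mult.commute[of "int b" "int a + int b"] by linarith
  then have "col n < int b" using a_pos by simp
  then show c': "col n + 1 \<le> int b" by simp
  have "int a * (col n + 1) \<le> int a * int b" using c' by (intro mult_left_mono) auto
  then have "int b * row n < int b * int a" using 1 by (simp add: mult.commute)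
  then show "row n + 1 \<le> int a" using b_pos by simp
qed

text \<open>The inequalities make \<open>int b * (j + 1) - int a * i\<close> a genuine remainder
  modulo \<open>a + b\<close>, which identifies \<open>i\<close> as the quotient.\<close>

lemma square_unique:
  assumes "int b * j < int a * (i + 1)" "int a * i < int b * (j + 1)" "i + j = int n"
  shows "col n = i" "row n = j"
proof -
  have "int b * (int n + 1) = (int a + int b) * i + (int b * (j + 1) - int a * i)"
    using assms(3) by (simp add: algebra_simps flip: assms(3))
  then show "col n = i" unfolding col_def
    by (rule int_div_pos_eq) (use assms in \<open>auto simp: algebra_simps\<close>)
  then show "row n = j" using assms(3) by (simp add: row_def)
qed

text \<open>The segment leaves a square through the right side if the upper right corner lies above
  it and through the top if below; before the last square that corner is never on the line.\<close>

lemma square_step: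
  assumes "n + 2 < a + b"
  shows "lv n + (int b - int a) > 0 \<Longrightarrow> col (Suc n) = col n + 1 \<and> row (Suc n) = row n"
    and "\<not> lv n + (int b - int a) > 0 \<Longrightarrow> col (Suc n) = col n \<and> row (Suc n) = row n + 1"
proof -
  have n: "n + 1 < a + b" using assms by simp
  note bd = square_bounds[OF n]
  have lv: "lv n + (int b - int a) = int b * (row n + 1) - int a * (col n + 1)"
    by (simp add: level_square algebra_simps)
  have sum: "col n + row n = int n" by (simp add: row_def)
  show "col (Suc n) = col n + 1 \<and> row (Suc n) = row n" if "lv n + (int b - int a) > 0"
  proof -
    have "int b * row n < int a * (col n + 1 + 1)" using bd a_pos by (simp add: distrib_left)
    moreover have "int a * (col n + 1) < int b * (row n + 1)" using that lv by simp
    ultimately show ?thesis using square_unique[of "row n" "col n + 1" "Suc n"] sum by simp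
  qed
  show "col (Suc n) = col n \<and> row (Suc n) = row n + 1" if "\<not> lv n + (int b - int a) > 0"
  proof -
    have "lv n + (int b - int a) \<noteq> 0" using level_end_iff[OF coprime_int, of n] assms by auto
    then have "int b * (row n + 1) < int a * (col n + 1)" using that lv by simp
    moreover have "int a * col n < int b * (row n + 1 + 1)" using bd b_pos by (simp add: distrib_left)
    ultimately show ?thesis using square_unique[of "row n + 1" "col n" "Suc n"] sum by simp
  qed
qed

definition side :: "nat \<Rightarrow> cell" where
  "side n = (if lv n + (int b - int a) > 0 then vertical_side (col n + 1) (row n)
     else horizontal_side (col n) (row n + 1))"

abbreviation "lower n \<equiv> lower_triangle (col n) (row n)"
abbreviation "upper n \<equiv> upper_triangle (col n) (row n)"
abbreviation "diag n \<equiv> diagonal (col n) (row n)"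

primrec cells :: "nat \<Rightarrow> cell list" where
  "cells 0 = [lower 0, diag 0, upper 0]"
| "cells (Suc n) = cells n @ [side n, lower (Suc n), diag (Suc n), upper (Suc n)]"

lemma set_cells:
  "set (cells m) = lower ` {..m} \<union> diag ` {..m} \<union> upper ` {..m} \<union> side ` {..<m}"
  by (induction m) (auto simp: atMost_Suc lessThan_Suc)

lemma mem_segment: "z \<in> segment \<longleftrightarrow> 0 \<le> fst z \<and> fst z \<le> real b \<and> real b * snd z = real a * fst z"
proof
  assume "z \<in> segment"
  then obtain u where "0 \<le> u" "u \<le> 1" "z = (u * real b, u * real a)"
    unfolding in_segment by (auto simp: seg_end.simps)
  then show "0 \<le> fst z \<and> fst z \<le> real b \<and> real b * snd z = real a * fst z"
    by (simp add: mult_left_le_one_le)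
next
  assume z: "0 \<le> fst z \<and> fst z \<le> real b \<and> real b * snd z = real a * fst z"
  have "z = (1 - fst z / real b) *\<^sub>R (0, 0) + (fst z / real b) *\<^sub>R seg_end (a, b)"
    using z b_pos by (cases z) (simp add: seg_end.simps field_simps)
  moreover have "0 \<le> fst z / real b" "fst z / real b \<le> 1" using z b_pos by auto
  ultimately show "z \<in> segment" unfolding in_segment by blast
qed

lemma mem_open_segment:
  "z \<in> open_segment (0, 0) (seg_end (a, b)) \<longleftrightarrow>
    0 < fst z \<and> fst z < real b \<and> real b * snd z = real a * fst z"
proof -
  have "z = (0, 0) \<longleftrightarrow> fst z = 0" "z = seg_end (a, b) \<longleftrightarrow> fst z = real b"
    if "real b * snd z = real a * fst z"
    using that a_pos b_pos by (cases z; auto simp: seg_end.simps)+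
  then show ?thesis unfolding open_segment_def by (auto simp: mem_segment)
qed

definition trace :: "cell \<Rightarrow> point set" where
  "trace c = rel_interior (region c) \<inter> segment"

text \<open>\<open>passed_before\<close> holds vacuously when a cell has empty trace; requiring
  nonempty traces gives transitivity and asymmetry.\<close>

definition strictly_before :: "cell \<Rightarrow> cell \<Rightarrow> bool" where
  "strictly_before c d \<longleftrightarrow> trace c \<noteq> {} \<and> trace d \<noteq> {} \<and> passed_before (a, b) c d"

lemma passed_before_trace:
  "passed_before (a, b) c d \<longleftrightarrow> (\<forall>p \<in> trace c. \<forall>q \<in> trace d. fst p < fst q)"
  by (simp only: passed_before_def trace_def)

lemma strictly_before_trans:
  assumes "strictly_before c d" "strictly_before d e"
  shows "strictly_before c e"
proof -
  obtain q where "q \<in> trace d" using assms(1) by (auto simp: strictly_before_def)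
  then have "fst p < fst r" if "p \<in> trace c" "r \<in> trace e" for p r
    using assms that unfolding strictly_before_def passed_before_trace by (meson order_less_trans)
  then show ?thesis using assms unfolding strictly_before_def passed_before_trace by blast
qed

lemma strictly_before_asym:
  assumes "strictly_before c d"
  shows "\<not> passed_before (a, b) d c"
proof
  assume "passed_before (a, b) d c"
  moreover obtain p q where "p \<in> trace c" "q \<in> trace d"
    using assms by (auto simp: strictly_before_def)
  ultimately show False using assms unfolding strictly_before_def passed_before_trace
    by (meson order_less_asym)
qed

lemma fst_less_by_sum:
  assumes "p \<in> segment" "q \<in> segment" "fst p + snd p < fst q + snd q"
  shows "fst p < fst q"
proof (rule ccontr)
  assume "\<not> fst p < fst q"
  then have "fst q \<le> fst p" by simp
  then have "real a * fst q \<le> real a * fst p" by (intro mult_left_mono) auto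
  then have "real b * snd q \<le> real b * snd p" using assms by (simp add: mem_segment)
  then have "snd q \<le> snd p" using b_pos by simp
  then show False using assms(3) \<open>fst q \<le> fst p\<close> by simp
qed

lemma fst_less_by_snd:
  assumes "p \<in> segment" "q \<in> segment" "snd p < snd q"
  shows "fst p < fst q"
proof -
  have "real b * snd p < real b * snd q" using assms(3) b_pos by simp
  then have "real a * fst p < real a * fst q" using assms by (simp add: mem_segment)
  then show ?thesis using a_pos by simp
qed

text \<open>Parametrised by the coordinate sum, so that the diagonal of square \<open>n\<close> is
  crossed exactly at \<open>n + 1\<close>.\<close>

definition point_at :: "real \<Rightarrow> point" where
  "point_at s = (real b * s / (real a + real b), real a * s / (real a + real b))"

lemma point_at_mem: "0 \<le> s \<Longrightarrow> s \<le> real a + real b \<Longrightarrow> point_at s \<in> segment"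
  using a_pos b_pos by (auto simp: point_at_def mem_segment divide_le_eq mult_left_mono)

lemma point_at_sum: "fst (point_at s) + snd (point_at s) = s"
  using a_pos b_pos by (simp add: point_at_def add.commute flip: add_divide_distrib distrib_right)

text \<open>The first four inequalities say that the segment crosses the line of the diagonal inside
  the open square.\<close>

lemma square_bounds_real:
  assumes "n + 1 < a + b"
  shows "real_of_int (col n) * (real a + real b) < real b * real_of_int (col n + row n + 1)"
    and "real_of_int (row n) * (real a + real b) < real a * real_of_int (col n + row n + 1)"
    and "real b * real_of_int (col n + row n + 1) < real_of_int (col n + 1) * (real a + real b)"
    and "real a * real_of_int (col n + row n + 1) < real_of_int (row n + 1) * (real a + real b)"
    and "0 < real_of_int (col n + row n + 1)" "real_of_int (col n + row n + 1) < real a + real b"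
proof -
  note bd = square_bounds[OF assms]
  have "real_of_int (int b * row n) < real_of_int (int a * (col n + 1))"
    using bd(5) by (simp only: of_int_less_iff)
  then have 1: "real b * real_of_int (row n) < real a * (real_of_int (col n) + 1)" by simp
  have "real_of_int (int a * col n) < real_of_int (int b * (row n + 1))"
    using bd(6) by (simp only: of_int_less_iff)
  then have 2: "real a * real_of_int (col n) < real b * (real_of_int (row n) + 1)" by simp
  show "real_of_int (col n) * (real a + real b) < real b * real_of_int (col n + row n + 1)"
    "real_of_int (row n) * (real a + real b) < real a * real_of_int (col n + row n + 1)"
    "real b * real_of_int (col n + row n + 1) < real_of_int (col n + 1) * (real a + real b)"
    "real a * real_of_int (col n + row n + 1) < real_of_int (row n + 1) * (real a + real b)"
    using 1 2 by (simp_all add: algebra_simps)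
  have "col n + row n + 1 = int (n + 1)" by (simp add: row_def)
  then show "0 < real_of_int (col n + row n + 1)" "real_of_int (col n + row n + 1) < real a + real b"
    using assms by auto
qed

lemma trace_lower_nonempty:
  assumes "n + 1 < a + b"
  shows "trace (lower n) \<noteq> {}"
proof -
  note bd = square_bounds[OF assms] and rb = square_bounds_real[OF assms]
  have p: "real b > 0" "real a > 0" "real a + real b > 0" using a_pos b_pos by auto
  \<comment> \<open>The maximum is the parameter at which the segment has passed both the left and
    the lower side; any \<open>s\<close> between it and the diagonal gives a point of the open
    triangle.\<close>
  have "max (real_of_int (col n) * (real a + real b) / real b) (real_of_int (row n) * (real a + real b) / real a)
      < real_of_int (col n + row n + 1)"
    using rb p by (simp add: divide_less_eq mult.commute)
  then obtain s where s: "max (real_of_int (col n) * (real a + real b) / real b)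
      (real_of_int (row n) * (real a + real b) / real a) < s" "s < real_of_int (col n + row n + 1)"
    using dense by blast
  have s1: "real_of_int (col n) * (real a + real b) < real b * s"
    "real_of_int (row n) * (real a + real b) < real a * s"
    using s(1) p by (auto simp: divide_less_eq mult.commute)
  have "0 \<le> real_of_int (col n) * (real a + real b)" using bd(1) by simp
  then have "0 < real b * s" using s1(1) by linarith
  then have "0 < s" using p by (simp add: zero_less_mult_iff)
  then have "point_at s \<in> segment" using point_at_mem rb(6) s(2) by simp
  moreover have "point_at s \<in> rel_interior (region (lower n))"
    unfolding rel_interior_lower_triangle using s1 s(2) p point_at_sum[of s]
    by (simp add: point_at_def less_divide_eq)
  ultimately show ?thesis by (auto simp: trace_def)
qed

lemma trace_upper_nonempty:
  assumes "n + 1 < a + b"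
  shows "trace (upper n) \<noteq> {}"
proof -
  note bd = square_bounds[OF assms] and rb = square_bounds_real[OF assms]
  have p: "real b > 0" "real a > 0" "real a + real b > 0" using a_pos b_pos by auto
  have "real_of_int (col n + row n + 1) <
      min (real_of_int (col n + 1) * (real a + real b) / real b) (real_of_int (row n + 1) * (real a + real b) / real a)"
    using rb p by (simp add: less_divide_eq mult.commute)
  then obtain s where s: "s < min (real_of_int (col n + 1) * (real a + real b) / real b)
      (real_of_int (row n + 1) * (real a + real b) / real a)" "real_of_int (col n + row n + 1) < s"
    using dense by blast
  have s1: "real b * s < real_of_int (col n + 1) * (real a + real b)"
    "real a * s < real_of_int (row n + 1) * (real a + real b)"
    using s(1) p by (auto simp: less_divide_eq mult.commute)
  have "real_of_int (col n + 1) * (real a + real b) \<le> real b * (real a + real b)"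
    using bd(2) by (intro mult_right_mono) linarith+
  then have "s \<le> real a + real b" using s1(1) p by (meson less_le_trans less_imp_le mult_less_cancel_left_pos)
  then have "point_at s \<in> segment" using point_at_mem rb(5) s(2) by simp
  moreover have "point_at s \<in> rel_interior (region (upper n))"
    unfolding rel_interior_upper_triangle using s1 s(2) p point_at_sum[of s]
    by (simp add: point_at_def divide_less_eq)
  ultimately show ?thesis by (auto simp: trace_def)
qed

lemma trace_diag_nonempty:
  assumes "n + 1 < a + b"
  shows "trace (diag n) \<noteq> {}"
proof -
  note rb = square_bounds_real[OF assms]
  have p: "real a + real b > 0" using a_pos by auto
  let ?s = "real_of_int (col n + row n + 1)"
  have "point_at ?s \<in> segment" using point_at_mem rb(5,6) by simp
  moreover have "point_at ?s \<in> rel_interior (region (diag n))"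
    unfolding rel_interior_diagonal mem_Collect_eq point_at_sum
    using rb(1,3) p by (simp add: point_at_def less_divide_eq divide_less_eq)
  ultimately show ?thesis by (auto simp: trace_def)
qed

lemma trace_side_nonempty:
  assumes "n + 2 < a + b"
  shows "trace (side n) \<noteq> {}"
proof -
  have n: "n + 1 < a + b" using assms by simp
  note bd = square_bounds[OF n]
  have lv: "lv n + (int b - int a) = int b * (row n + 1) - int a * (col n + 1)"
    by (simp add: level_square algebra_simps)
  have p: "real b > 0" "real a > 0" using a_pos b_pos by auto
  have "real_of_int (int b * row n) < real_of_int (int a * (col n + 1))"
    "real_of_int (int a * col n) < real_of_int (int b * (row n + 1))"
    using bd(5,6) by (simp_all only: of_int_less_iff)
  then have 1: "real b * real_of_int (row n) < real a * real_of_int (col n + 1)"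
    and 2: "real a * real_of_int (col n) < real b * real_of_int (row n + 1)" by simp_all
  show ?thesis
  proof (cases "lv n + (int b - int a) > 0")
    case True
    then have "int a * (col n + 1) < int b * (row n + 1)" using lv by simp
    then have "real_of_int (int a * (col n + 1)) < real_of_int (int b * (row n + 1))"
      by (simp only: of_int_less_iff)
    then have 3: "real a * real_of_int (col n + 1) < real b * real_of_int (row n + 1)" by simp
    let ?z = "(real_of_int (col n + 1), real a * real_of_int (col n + 1) / real b)"
    have "?z \<in> segment" using bd(1,2) p by (auto simp: mem_segment)
    moreover have "?z \<in> rel_interior (region (side n))"
      using True 1 3 p by (simp add: side_def rel_interior_vertical_side less_divide_eq divide_less_eq mult.commute)
    ultimately show ?thesis by (auto simp: trace_def)
  next
    case False
    moreover have "lv n + (int b - int a) \<noteq> 0" using level_end_iff[OF coprime_int, of n] assms by auto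
    ultimately have "int b * (row n + 1) < int a * (col n + 1)" using lv by simp
    then have "real_of_int (int b * (row n + 1)) < real_of_int (int a * (col n + 1))"
      by (simp only: of_int_less_iff)
    then have 3: "real b * real_of_int (row n + 1) < real a * real_of_int (col n + 1)" by simp
    let ?z = "(real b * real_of_int (row n + 1) / real a, real_of_int (row n + 1))"
    have "real_of_int (row n + 1) \<le> real a" using bd(4) by linarith
    then have "real b * real_of_int (row n + 1) / real a \<le> real b"
      using p by (simp add: divide_le_eq mult_left_mono)
    then have "?z \<in> segment" using bd(3) p unfolding mem_segment by simp
    moreover have "?z \<in> rel_interior (region (side n))"
      using False 2 3 p by (simp add: side_def rel_interior_horizontal_side less_divide_eq divide_less_eq mult.commute)
    ultimately show ?thesis by (auto simp: trace_def)
  qed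
qed

lemma before_lower_diag:
  "n + 1 < a + b \<Longrightarrow> strictly_before (lower n) (diag n)"
  unfolding strictly_before_def passed_before_def
  using trace_lower_nonempty[of n] trace_diag_nonempty[of n]
  by (auto simp: rel_interior_lower_triangle rel_interior_diagonal intro!: fst_less_by_sum)

lemma before_diag_upper:
  "n + 1 < a + b \<Longrightarrow> strictly_before (diag n) (upper n)"
  unfolding strictly_before_def passed_before_def
  using trace_upper_nonempty[of n] trace_diag_nonempty[of n]
  by (auto simp: rel_interior_upper_triangle rel_interior_diagonal intro!: fst_less_by_sum)

lemma before_upper_side:
  assumes "n + 2 < a + b"
  shows "strictly_before (upper n) (side n)"
proof -
  have "fst p < fst q" if "p \<in> rel_interior (region (upper n)) \<inter> segment"
    "q \<in> rel_interior (region (side n)) \<inter> segment" for p q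
  proof (cases "lv n + (int b - int a) > 0")
    case True
    then show ?thesis using that
      by (simp add: side_def rel_interior_upper_triangle rel_interior_vertical_side)
  next
    case False
    then have "snd p < snd q" using that
      by (simp add: side_def rel_interior_upper_triangle rel_interior_horizontal_side)
    then show ?thesis using that fst_less_by_snd by blast
  qed
  then show ?thesis using trace_upper_nonempty[of n] trace_side_nonempty[OF assms] assms
    by (auto simp: strictly_before_def passed_before_def)
qed

lemma before_side_lower:
  assumes "n + 2 < a + b"
  shows "strictly_before (side n) (lower (Suc n))"
proof -
  have "fst p < fst q" if "p \<in> rel_interior (region (side n)) \<inter> segment"
    "q \<in> rel_interior (region (lower (Suc n))) \<inter> segment" for p q
  proof (cases "lv n + (int b - int a) > 0")
    case True
    then show ?thesis using that square_step(1)[OF assms]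
      by (simp add: side_def rel_interior_lower_triangle rel_interior_vertical_side)
  next
    case False
    then have "snd p < snd q" using that square_step(2)[OF assms]
      by (simp add: side_def rel_interior_lower_triangle rel_interior_horizontal_side)
    then show ?thesis using that fst_less_by_snd by blast
  qed
  then show ?thesis using trace_lower_nonempty[of "Suc n"] trace_side_nonempty[OF assms] assms
    by (auto simp: strictly_before_def passed_before_def)
qed

lemma cells_sorted: "m + 1 < a + b \<Longrightarrow> sorted_wrt strictly_before (cells m)"
proof -
  have last: "cells m \<noteq> [] \<and> last (cells m) = upper m" for m
    by (cases m) auto
  assume "m + 1 < a + b"
  then have "successively strictly_before (cells m)"
  proof (induction m)
    case 0
    then show ?case using before_lower_diag before_diag_upper by simp
  next
    case (Suc m)
    then show ?case using last[of m]
        before_upper_side[of m] before_side_lower[of m] before_lower_diag[of "Suc m"] before_diag_upper[of "Suc m"]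
      by (simp add: successively_append_iff)
  qed
  then show ?thesis
    by (subst (asm) successively_iff_sorted_wrt_strong) (use strictly_before_trans in blast)+
qed

lemma met_square:
  assumes "interior (unit_square i j) \<inter> segment \<noteq> {}"
  obtains n where "n + 1 < a + b" "col n = i" "row n = j"
proof -
  obtain z where z: "z \<in> interior (unit_square i j)" "z \<in> segment" using assms by blast
  have x: "real_of_int i < fst z" "fst z < real_of_int i + 1" "real_of_int j < snd z" "snd z < real_of_int j + 1"
    using z(1) by (auto simp: unit_square_def interior_Times)
  have s: "0 \<le> fst z" "fst z \<le> real b" "real b * snd z = real a * fst z" using z(2) by (auto simp: mem_segment)
  have p: "real b > 0" "real a > 0" using a_pos b_pos by auto
  have "real b * snd z \<ge> 0" "real b * snd z \<le> real b * real a"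
    using s p by (auto simp: mult.commute mult_left_mono)
  then have y: "0 \<le> snd z" "snd z \<le> real a" using p by (auto simp: zero_le_mult_iff)
  have nn: "0 \<le> i" "0 \<le> j" "i < int b" "j < int a" using x s y by linarith+
  have "real b * real_of_int j < real b * snd z" "real a * fst z < real a * (real_of_int i + 1)"
    using x p by auto
  then have "real_of_int (int b * j) < real_of_int (int a * (i + 1))" using s by simp
  then have 1: "int b * j < int a * (i + 1)" by (simp only: of_int_less_iff)
  have "real a * real_of_int i < real a * fst z" "real b * snd z < real b * (real_of_int j + 1)"
    using x p by auto
  then have "real_of_int (int a * i) < real_of_int (int b * (j + 1))" using s by simp
  then have 2: "int a * i < int b * (j + 1)" by (simp only: of_int_less_iff)
  have "i + j = int (nat (i + j))" using nn by simp
  then show ?thesis using that[of "nat (i + j)"] square_unique[OF 1 2] nn by force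
qed

lemma met_by_segment_lower: "met_by_segment (a, b) (lower_triangle i j) \<longleftrightarrow>
    interior (region (lower_triangle i j)) \<inter> segment \<noteq> {}"
  and met_by_segment_upper: "met_by_segment (a, b) (upper_triangle i j) \<longleftrightarrow>
    interior (region (upper_triangle i j)) \<inter> segment \<noteq> {}"
  and met_by_segment_diagonal: "met_by_segment (a, b) (diagonal i j) \<longleftrightarrow>
    region (diagonal i j) \<inter> open_segment (0, 0) (seg_end (a, b)) \<noteq> {}"
  and met_by_segment_horizontal: "met_by_segment (a, b) (horizontal_side i j) \<longleftrightarrow>
    region (horizontal_side i j) \<inter> open_segment (0, 0) (seg_end (a, b)) \<noteq> {}"
  and met_by_segment_vertical: "met_by_segment (a, b) (vertical_side i j) \<longleftrightarrow>
    region (vertical_side i j) \<inter> open_segment (0, 0) (seg_end (a, b)) \<noteq> {}"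
  by (simp_all only: lower_triangle_def upper_triangle_def diagonal_def horizontal_side_def
      vertical_side_def met_by_segment.simps region.simps)

lemma no_lattice_point:
  assumes "int b * j = int a * i" "0 < i" "i < int b"
  shows False
proof -
  have "int b dvd int a * i" using assms(1) by (metis dvd_triv_left)
  then have "int b dvd i" using coprime_int(1) by (simp add: coprime_dvd_mult_right_iff coprime_commute)
  then show False using assms zdvd_not_zless by blast
qed

text \<open>\<open>met_by_segment\<close> tests the closed edge, so contact in a lattice point must
  be excluded. A proper crossing then makes the edge the top of square
  \<open>i + j - 1\<close>.\<close>

lemma met_horizontal_side:
  assumes "met_by_segment (a, b) (horizontal_side i j)"
  shows "horizontal_side i j \<in> side ` {..<a + b - 2}"
proof -
  obtain z where "z \<in> region (horizontal_side i j)" "z \<in> open_segment (0, 0) (seg_end (a, b))"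
    using assms unfolding met_by_segment_horizontal by blast
  moreover define x where "x = fst z"
  ultimately have x: "real_of_int i \<le> x" "x \<le> real_of_int (i + 1)" "0 < x" "x < real b"
    "real b * real_of_int j = real a * x"
    unfolding region_horizontal_side mem_open_segment by simp_all
  have p: "real b > 0" "real a > 0" using a_pos b_pos by auto
  have lat: "x \<noteq> real_of_int l" for l
  proof
    assume l: "x = real_of_int l"
    then have "real_of_int (int b * j) = real_of_int (int a * l)" using x(5) by simp
    then have "int b * j = int a * l" by (simp only: of_int_eq_iff)
    moreover have "0 < l" "l < int b" using x l by linarith+
    ultimately show False by (rule no_lattice_point)
  qed
  have xs: "real_of_int i < x" "x < real_of_int (i + 1)" using x lat by (metis order_le_less)+
  have "real a * real_of_int i < real b * real_of_int j" "real b * real_of_int j < real a * real_of_int (i + 1)"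
    using x(5) xs p by auto
  then have "real_of_int (int a * i) < real_of_int (int b * j)" "real_of_int (int b * j) < real_of_int (int a * (i + 1))"
    by auto
  then have 1: "int a * i < int b * j" "int b * j < int a * (i + 1)" by (simp_all only: of_int_less_iff)
  have "0 < real b * real_of_int j" "real b * real_of_int j < real b * real a" using x p by auto
  then have j: "0 < j" "j < int a" using p by (auto simp: zero_less_mult_iff)
  have i: "0 \<le> i" "i < int b" using xs x by linarith+
  define n where "n = nat (i + j - 1)"
  have n: "int n = i + (j - 1)" using i j by (simp add: n_def)
  have "int b * (j - 1) < int a * (i + 1)" using 1 by (simp add: algebra_simps)
  moreover have "int a * i < int b * (j - 1 + 1)" using 1 by simp
  ultimately have cr: "col n = i" "row n = j - 1" using square_unique[of "j - 1" i n] n by simp_all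
  have "\<not> lv n + (int b - int a) > 0" using 1 by (simp add: level_square cr algebra_simps)
  then have "side n = horizontal_side i j" by (simp add: side_def cr)
  moreover have "n < a + b - 2" using n i j by linarith
  ultimately show ?thesis by force
qed

lemma met_vertical_side:
  assumes "met_by_segment (a, b) (vertical_side i j)"
  shows "vertical_side i j \<in> side ` {..<a + b - 2}"
proof -
  obtain z where "z \<in> region (vertical_side i j)" "z \<in> open_segment (0, 0) (seg_end (a, b))"
    using assms unfolding met_by_segment_vertical by blast
  moreover define y where "y = snd z"
  ultimately have y: "real_of_int j \<le> y" "y \<le> real_of_int (j + 1)" "0 < real_of_int i" "real_of_int i < real b"
    "real b * y = real a * real_of_int i"
    unfolding region_vertical_side mem_open_segment by simp_all
  have p: "real b > 0" "real a > 0" using a_pos b_pos by auto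
  have i: "0 < i" "i < int b" using y by linarith+
  have lat: "y \<noteq> real_of_int l" for l
  proof
    assume l: "y = real_of_int l"
    then have "real_of_int (int b * l) = real_of_int (int a * i)" using y(5) by simp
    then have "int b * l = int a * i" by (simp only: of_int_eq_iff)
    then show False using i by (rule no_lattice_point)
  qed
  have ys: "real_of_int j < y" "y < real_of_int (j + 1)" using y lat by (metis order_le_less)+
  have "real b * real_of_int j < real a * real_of_int i" "real a * real_of_int i < real b * real_of_int (j + 1)"
    using ys p unfolding y(5)[symmetric] by auto
  then have "real_of_int (int b * j) < real_of_int (int a * i)" "real_of_int (int a * i) < real_of_int (int b * (j + 1))"
    by auto
  then have 1: "int b * j < int a * i" "int a * i < int b * (j + 1)" by (simp_all only: of_int_less_iff)
  have "0 < real b * y" "real b * y < real b * real a" unfolding y(5) using y p by auto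
  then have "0 < y" "y < real a" using p by (auto simp: zero_less_mult_iff)
  then have j: "0 \<le> j" "j < int a" using ys by linarith+
  define n where "n = nat (i - 1 + j)"
  have n: "int n = i - 1 + j" using i j by (simp add: n_def)
  have "int b * j < int a * (i - 1 + 1)" using 1 by simp
  moreover have "int a * (i - 1) < int b * (j + 1)" using 1 by (simp add: algebra_simps)
  ultimately have cr: "col n = i - 1" "row n = j" using square_unique[of j "i - 1" n] n by simp_all
  have "lv n + (int b - int a) > 0" using 1 by (simp add: level_square cr algebra_simps)
  then have "side n = vertical_side i j" by (simp add: side_def cr)
  moreover have "n < a + b - 2" using n i j by linarith
  ultimately show ?thesis by force
qed

lemma met_cells: "{c \<in> pre_snake_cells (a, b). met_by_segment (a, b) c} = set (cells (a + b - 2))"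
proof
  show "{c \<in> pre_snake_cells (a, b). met_by_segment (a, b) c} \<subseteq> set (cells (a + b - 2))"
  proof
    fix c assume c: "c \<in> {c \<in> pre_snake_cells (a, b). met_by_segment (a, b) c}"
    then obtain i j where ij: "c \<in> square_cells i j" "interior (unit_square i j) \<inter> segment \<noteq> {}"
      by (auto simp: pre_snake_cells_def simp del: seg_end.simps)
    obtain n where n: "n + 1 < a + b" "col n = i" "row n = j" using met_square[OF ij(2)] .
    have le: "n \<le> a + b - 2" using n by simp
    have "c \<in> {lower n, upper n, diag n} \<or> c \<in> side ` {..<a + b - 2}"
      using ij(1) c met_horizontal_side met_vertical_side unfolding square_cells_eq n(2,3) by blast
    then show "c \<in> set (cells (a + b - 2))" unfolding set_cells using le by blast
  qed
  have sq: "square_cells (col n) (row n) \<subseteq> pre_snake_cells (a, b)" if n: "n + 1 < a + b" for n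
  proof -
    obtain z where z: "z \<in> rel_interior (region (lower n))" "z \<in> segment"
      using trace_lower_nonempty[OF n] by (auto simp: trace_def)
    have "z \<in> interior (unit_square (col n) (row n))"
      using z(1) by (cases z) (auto simp: rel_interior_lower_triangle unit_square_def interior_Times)
    then show ?thesis using z(2) unfolding pre_snake_cells_def by blast
  qed
  show "set (cells (a + b - 2)) \<subseteq> {c \<in> pre_snake_cells (a, b). met_by_segment (a, b) c}"
  proof
    fix c assume "c \<in> set (cells (a + b - 2))"
    then consider n where "n \<le> a + b - 2" "c = lower n" | n where "n \<le> a + b - 2" "c = diag n"
      | n where "n \<le> a + b - 2" "c = upper n" | n where "n < a + b - 2" "c = side n"
      unfolding set_cells by blast
    then show "c \<in> {c \<in> pre_snake_cells (a, b). met_by_segment (a, b) c}"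
    proof cases
      case 1
      then have n: "n + 1 < a + b" using a_pos b_pos by linarith
      then show ?thesis using 1 sq[OF n] trace_lower_nonempty[OF n]
        by (auto simp: trace_def met_by_segment_lower rel_interior_lower_triangle interior_lower_triangle square_cells_eq)
    next
      case 2
      then have n: "n + 1 < a + b" using a_pos b_pos by linarith
      obtain z where z: "z \<in> rel_interior (region (diag n))" "z \<in> segment"
        using trace_diag_nonempty[OF n] by (auto simp: trace_def)
      have "z \<in> region (diag n)" using z(1) rel_interior_subset by blast
      moreover have "z \<in> open_segment (0, 0) (seg_end (a, b))"
        using z square_bounds(1,2)[OF n] unfolding mem_open_segment mem_segment rel_interior_diagonal by auto
      ultimately show ?thesis using 2 sq[OF n] by (auto simp: met_by_segment_diagonal square_cells_eq)
    next
      case 3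
      then have n: "n + 1 < a + b" using a_pos b_pos by linarith
      then show ?thesis using 3 sq[OF n] trace_upper_nonempty[OF n]
        by (auto simp: trace_def met_by_segment_upper rel_interior_upper_triangle interior_upper_triangle square_cells_eq)
    next
      case 4
      then have n: "n + 2 < a + b" "n + 1 < a + b" "Suc n + 1 < a + b" by linarith+
      obtain z where z: "z \<in> rel_interior (region (side n))" "z \<in> segment"
        using trace_side_nonempty[OF n(1)] by (auto simp: trace_def)
      have zr: "z \<in> region (side n)" using z(1) rel_interior_subset by blast
      show ?thesis
      proof (cases "lv n + (int b - int a) > 0")
        case True
        have "col (Suc n) = col n + 1" using square_step(1)[OF n(1) True] by simp
        then have "z \<in> open_segment (0, 0) (seg_end (a, b))"
          using z square_bounds(1,2)[OF n(3)] square_bounds(1)[OF n(2)] True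
          unfolding mem_open_segment mem_segment side_def by (auto simp: rel_interior_vertical_side)
        then show ?thesis using 4 sq[OF n(2)] zr True
          by (auto simp: side_def met_by_segment_vertical square_cells_eq)
      next
        case False
        then have "z \<in> open_segment (0, 0) (seg_end (a, b))"
          using z square_bounds(1,2)[OF n(2)]
          unfolding mem_open_segment mem_segment side_def by (auto simp: rel_interior_horizontal_side)
        then show ?thesis using 4 sq[OF n(2)] zr False
          by (auto simp: side_def met_by_segment_horizontal square_cells_eq)
      qed
    qed
  qed
qed

lemma passage_eq: "passage (a, b) = cells (a + b - 2)"
proof -
  have m: "a + b - 2 + 1 < a + b" using a_pos b_pos by linarith
  have sb: "sorted_wrt strictly_before (cells (a + b - 2))" by (rule cells_sorted[OF m])
  have sorted: "sorted_wrt (passed_before (a, b)) (cells (a + b - 2))"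
    by (rule sorted_wrt_mono_rel[OF _ sb]) (simp add: strictly_before_def)
  have distinct: "distinct xs" if "sorted_wrt strictly_before xs" for xs
  proof -
    have "\<not> strictly_before c c" for c using strictly_before_asym[of c c] by (auto simp: strictly_before_def)
    then show ?thesis using that by (induction xs) auto
  qed
  have trace: "trace c \<noteq> {}" if c: "c \<in> set (cells (a + b - 2))" for c
  proof -
    consider n where "n \<le> a + b - 2" "c \<in> {lower n, diag n, upper n}" | n where "n < a + b - 2" "c = side n"
      using c unfolding set_cells by auto
    then show ?thesis
    proof cases
      case 1
      then have "n + 1 < a + b" using m by linarith
      then show ?thesis
        using 1(2) trace_lower_nonempty[of n] trace_diag_nonempty[of n] trace_upper_nonempty[of n] by auto
    next
      case 2
      then show ?thesis using trace_side_nonempty[of n] by simp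
    qed
  qed
  show ?thesis unfolding passage_def met_cells
  proof (rule the_equality)
    show "distinct (cells (a + b - 2)) \<and> set (cells (a + b - 2)) = set (cells (a + b - 2)) \<and>
        sorted_wrt (passed_before (a, b)) (cells (a + b - 2))"
      using distinct[OF sb] sorted by simp
    fix cs assume cs: "distinct cs \<and> set cs = set (cells (a + b - 2)) \<and> sorted_wrt (passed_before (a, b)) cs"
    show "cs = cells (a + b - 2)"
    proof (rule sorted_wrt_distinct_unique[where P = "passed_before (a, b)"])
      fix c d assume "c \<in> set cs" "d \<in> set cs" "passed_before (a, b) c d"
      then have "strictly_before c d" using trace cs by (auto simp: strictly_before_def)
      then show "\<not> passed_before (a, b) d c" by (rule strictly_before_asym)
    qed (use cs sorted distinct[OF sb] in auto)
  qed
qed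


section \<open>Signs of the triangles and edges\<close>

lemma height_lattice_point: "height a b (lattice_point i j) = real_of_int (int b * j - int a * i)"
  by (simp add: height_def)

text \<open>The two ends of the diagonal lie strictly on opposite sides of the line, so the corner
  at the right angle decides whether one or two vertices are above.\<close>

lemma quadrilateral_lower:
  assumes "n + 1 < a + b" "lv n \<noteq> 0"
  shows "quadrilateral (region (lower n) \<inter> on_or_above (a, b)) \<longleftrightarrow> lv n > 0"
proof -
  note bd = square_bounds[OF assms(1)]
  define i where "i = col n"
  define j where "j = row n"
  define p where "p = lattice_point i j"
  define q where "q = lattice_point i (j + 1)"
  define r where "r = lattice_point (i + 1) j"
  have hp: "height a b p = real_of_int (lv n)"
    unfolding p_def height_lattice_point level_square i_def j_def ..
  have hq: "height a b q > 0"
    unfolding q_def height_lattice_point of_int_0_less_iff using bd(6) by (simp add: i_def j_def)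
  have hr: "height a b r < 0"
    unfolding r_def height_lattice_point of_int_less_0_iff using bd(5) by (simp add: i_def j_def)
  have S: "region (lower n) = convex hull {p, q, r}"
    by (simp add: lower_triangle_def p_def q_def r_def i_def j_def insert_commute)
  show ?thesis
  proof (cases "lv n > 0")
    case True
    have "quadrilateral (convex hull {p, q, r} \<inter> on_or_above (a, b))"
      by (rule quadrilateral_two_above[where gp = "\<lambda>z. real_of_int (i + j + 1) - fst z - snd z"
          and gq = "\<lambda>z. snd z - real_of_int j" and gr = "\<lambda>z. fst z - real_of_int i"])
        (use True hp hq hr in \<open>auto simp: p_def q_def r_def algebra_simps prod_eq_iff\<close>)
    then show ?thesis using True S by simp
  next
    case False
    have "\<not> quadrilateral (convex hull {q, p, r} \<inter> on_or_above (a, b))"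
      by (rule not_quadrilateral_one_above) (use False hp hq hr in auto)
    then show ?thesis using False S by (simp add: insert_commute)
  qed
qed

text \<open>In the last square the upper right corner lies on the line and the part above is only a
  triangle, in accordance with the strict comparison.\<close>

lemma quadrilateral_upper:
  assumes "n + 1 < a + b"
  shows "quadrilateral (region (upper n) \<inter> on_or_above (a, b)) \<longleftrightarrow> lv n + (int b - int a) > 0"
proof -
  note bd = square_bounds[OF assms(1)]
  define i where "i = col n"
  define j where "j = row n"
  define p where "p = lattice_point (i + 1) (j + 1)"
  define q where "q = lattice_point i (j + 1)"
  define r where "r = lattice_point (i + 1) j"
  have hp: "height a b p = real_of_int (lv n + (int b - int a))"
    unfolding p_def height_lattice_point level_square i_def j_def by (simp add: algebra_simps)
  have hq: "height a b q > 0"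
    unfolding q_def height_lattice_point of_int_0_less_iff using bd(6) by (simp add: i_def j_def)
  have hr: "height a b r < 0"
    unfolding r_def height_lattice_point of_int_less_0_iff using bd(5) by (simp add: i_def j_def)
  have S: "region (upper n) = convex hull {p, q, r}"
    by (simp add: upper_triangle_def p_def q_def r_def i_def j_def insert_commute)
  show ?thesis
  proof (cases "lv n + (int b - int a) > 0")
    case True
    then have hp': "height a b p > 0" unfolding hp of_int_0_less_iff .
    have "quadrilateral (convex hull {p, q, r} \<inter> on_or_above (a, b))"
      by (rule quadrilateral_two_above[where gp = "\<lambda>z. fst z + snd z - real_of_int (i + j + 1)"
          and gq = "\<lambda>z. real_of_int (i + 1) - fst z" and gr = "\<lambda>z. real_of_int (j + 1) - snd z"])
        (use hp' hq hr in \<open>auto simp: p_def q_def r_def algebra_simps prod_eq_iff\<close>)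
    then show ?thesis using True S by simp
  next
    case False
    then have hp': "height a b p \<le> 0" unfolding hp of_int_le_0_iff by simp
    have "\<not> quadrilateral (convex hull {q, p, r} \<inter> on_or_above (a, b))"
      by (rule not_quadrilateral_one_above) (use hp' hq hr in auto)
    then show ?thesis using False S by (simp add: insert_commute)
  qed
qed

lemma hd_passage: "hd (passage (a, b)) = lower_triangle 0 0"
proof -
  have "hd (cells m) = lower 0 \<and> cells m \<noteq> []" for m by (induction m) auto
  moreover have "col 0 = 0" "row 0 = 0" using square_unique[of 0 0 0] a_pos b_pos by auto
  ultimately show ?thesis by (simp add: passage_eq)
qed

text \<open>Level 0 occurs only for \<open>n = 0\<close>, where the rule for the first triangle
  gives \<open>Minus\<close>; so \<open>\<ge>\<close> covers both rules.\<close>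

lemma triangle_sign_lower:
  assumes "n + 1 < a + b"
  shows "triangle_sign (a, b) (lower n) = (if lv n \<ge> 0 then Minus else Plus)"
proof (cases "n = 0")
  case True
  have "lower n = hd (passage (a, b))" using True square_unique[of 0 0 0] a_pos b_pos by (simp add: hd_passage)
  then show ?thesis using True level_0[of "int a" "int b"] a_pos b_pos by (simp add: triangle_sign_def)
next
  case False
  then have "col n \<noteq> 0 \<or> row n \<noteq> 0" by (auto simp: row_def)
  then have "lower n \<noteq> hd (passage (a, b))" by (auto simp: hd_passage lower_triangle_def)
  moreover have "lv n \<noteq> 0" using level_zero_iff[OF coprime_int, of n] False assms by simp
  ultimately show ?thesis using quadrilateral_lower[OF assms] by (simp add: triangle_sign_def)
qed

lemma triangle_sign_upper:
  assumes "n + 1 < a + b"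
  shows "triangle_sign (a, b) (upper n) = (if lv n + (int b - int a) > 0 then Minus else Plus)"
proof -
  have "upper n \<noteq> hd (passage (a, b))"
    using square_bounds(1)[OF assms] by (auto simp: hd_passage lower_triangle_def upper_triangle_def)
  then show ?thesis unfolding triangle_sign_def using quadrilateral_upper[OF assms] by simp
qed

lemma midpoint_above:
  "midpoint (lattice_point i j) (lattice_point i' j') \<in> on_or_above (a, b) \<longleftrightarrow>
   0 \<le> int b * (j + j') - int a * (i + i')"
proof -
  have "height a b (midpoint (lattice_point i j) (lattice_point i' j')) =
      real_of_int (int b * (j + j') - int a * (i + i')) / 2"
    by (simp add: height_def midpoint_def field_simps)
  moreover have "0 \<le> real_of_int x / 2 \<longleftrightarrow> 0 \<le> x" for x by simp
  ultimately show ?thesis unfolding on_or_above_height mem_Collect_eq by metis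
qed

lemma F_signs_edges:
  "F_signs k (a, b) (diagonal i j) = replicate k (edge_sign Minus (int b * (2 * j + 1) - int a * (2 * i + 1)))"
  "F_signs k (a, b) (horizontal_side i j) = replicate k (edge_sign Minus (int b * (2 * j) - int a * (2 * i + 1)))"
  "F_signs k (a, b) (vertical_side i j) = replicate k (edge_sign Minus (int b * (2 * j + 1) - int a * (2 * i)))"
proof -
  have minus: "(if 0 \<le> x then Minus else Plus) = edge_sign Minus x" for x
    by (simp add: edge_sign_def)
  have "i + (i + 1) = 2 * i + 1" "j + 1 + j = 2 * j + 1" "j + j = 2 * j" "i + i = 2 * i" "j + (j + 1) = 2 * j + 1"
    by simp_all
  then show
    "F_signs k (a, b) (diagonal i j) = replicate k (edge_sign Minus (int b * (2 * j + 1) - int a * (2 * i + 1)))"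
    "F_signs k (a, b) (horizontal_side i j) = replicate k (edge_sign Minus (int b * (2 * j) - int a * (2 * i + 1)))"
    "F_signs k (a, b) (vertical_side i j) = replicate k (edge_sign Minus (int b * (2 * j + 1) - int a * (2 * i)))"
    by (simp_all only: diagonal_def horizontal_side_def vertical_side_def F_signs.simps midpoint_above minus)
qed

text \<open>The point (b/2, a/2) is not a lattice point, as \<open>a\<close> and \<open>b\<close>
  are not both even. An edge containing it therefore has it as its own midpoint.\<close>

lemma central_edge_iff:
  "central_edge (a, b) (diagonal i j) \<longleftrightarrow> int b = 2 * i + 1 \<and> int a = 2 * j + 1"
  "central_edge (a, b) (horizontal_side i j) \<longleftrightarrow> int b = 2 * i + 1 \<and> int a = 2 * j"
  "central_edge (a, b) (vertical_side i j) \<longleftrightarrow> int b = 2 * i \<and> int a = 2 * j + 1"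
proof -
  have odd: "odd a \<or> odd b" using coprime by (metis coprime_common_divisor odd_one)
  have mid: "midpoint (0, 0) (seg_end (a, b)) = (real b / 2, real a / 2)"
    by (simp add: midpoint_def seg_end.simps)
  have ex: "\<exists>p q. diagonal i j = Edge p q" "\<exists>p q. horizontal_side i j = Edge p q"
    "\<exists>p q. vertical_side i j = Edge p q"
    by (auto simp: diagonal_def horizontal_side_def vertical_side_def)
  show "central_edge (a, b) (diagonal i j) \<longleftrightarrow> int b = 2 * i + 1 \<and> int a = 2 * j + 1"
  proof -
    have "central_edge (a, b) (diagonal i j) \<longleftrightarrow>
        2 * i \<le> int b \<and> int b \<le> 2 * i + 2 \<and> int a + int b = 2 * (i + j + 1)"
      unfolding central_edge_def mid region_diagonal mem_Collect_eq fst_conv snd_conv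
      using ex(1) by (simp add: field_simps) linarith
    then show ?thesis using odd by presburger
  qed
  show "central_edge (a, b) (horizontal_side i j) \<longleftrightarrow> int b = 2 * i + 1 \<and> int a = 2 * j"
  proof -
    have "central_edge (a, b) (horizontal_side i j) \<longleftrightarrow>
        2 * i \<le> int b \<and> int b \<le> 2 * i + 2 \<and> int a = 2 * j"
      unfolding central_edge_def mid region_horizontal_side mem_Collect_eq fst_conv snd_conv
      using ex(2) by (simp add: field_simps) linarith
    then show ?thesis using odd by presburger
  qed
  show "central_edge (a, b) (vertical_side i j) \<longleftrightarrow> int b = 2 * i \<and> int a = 2 * j + 1"
  proof -
    have "central_edge (a, b) (vertical_side i j) \<longleftrightarrow>
        2 * j \<le> int a \<and> int a \<le> 2 * j + 2 \<and> int b = 2 * i"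
      unfolding central_edge_def mid region_vertical_side mem_Collect_eq fst_conv snd_conv
      using ex(3) by (simp add: field_simps) linarith
    then show ?thesis using odd by presburger
  qed
qed

end

text \<open>Applied to doubled midpoints of edges: one on the line is the midpoint of the segment,
  so ties in \<open>edge_sign\<close> occur on the central edge only.\<close>

lemma coprime_proportional:
  fixes a b x y :: int
  assumes "coprime a b" "b * y = a * x" "0 < x" "x < 2 * b"
  shows "x = b" "y = a"
proof -
  have "b dvd a * x" using assms(2) by (metis dvd_triv_left)
  then have "b dvd x" using assms(1) by (simp add: coprime_dvd_mult_right_iff coprime_commute)
  then obtain c where c: "x = b * c" ..
  have "b > 0" using assms by simp
  then have "0 < c" "c < 2" using assms(3,4) c by (auto simp: zero_less_mult_iff)
  then show "x = b" using c by simp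
  then show "y = a" using assms(2) \<open>b > 0\<close> by simp
qed

context fraction_segment
begin

lemma G_signs_diag:
  assumes "n + 1 < a + b"
  shows "G_signs k (a, b) (diag n) = replicate k (edge_sign Plus (2 * lv n + (int b - int a)))"
proof -
  note bd = square_bounds[OF assms]
  let ?x = "int b * (2 * row n + 1) - int a * (2 * col n + 1)"
  have x: "2 * lv n + (int b - int a) = ?x" by (simp add: level_square algebra_simps)
  have "central_edge (a, b) (diag n) \<longleftrightarrow> ?x = 0"
    unfolding central_edge_iff
    using coprime_proportional[OF coprime_int(1), of "2 * row n + 1" "2 * col n + 1"] bd by auto
  then show ?thesis unfolding G_signs_def F_signs_edges x by (auto simp: edge_sign_def)
qed

text \<open>The shared side joins the upper right corner of square \<open>n\<close> to the lower
  left corner of the next one.\<close>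

lemma side_value:
  assumes "n + 2 < a + b"
  shows "lv n + lv (Suc n) + (int b - int a) =
    (if lv n + (int b - int a) > 0 then int b * (2 * row n + 1) - int a * (2 * (col n + 1))
     else int b * (2 * (row n + 1)) - int a * (2 * col n + 1))"
proof (cases "lv n + (int b - int a) > 0")
  case True
  then have "col (Suc n) = col n + 1" "row (Suc n) = row n" using square_step(1)[OF assms] by auto
  then have "lv n + lv (Suc n) + (int b - int a) = int b * (2 * row n + 1) - int a * (2 * (col n + 1))"
    unfolding level_square by (simp add: algebra_simps)
  then show ?thesis using True by simp
next
  case False
  then have "col (Suc n) = col n" "row (Suc n) = row n + 1" using square_step(2)[OF assms] by auto
  then have "lv n + lv (Suc n) + (int b - int a) = int b * (2 * (row n + 1)) - int a * (2 * col n + 1)"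
    unfolding level_square by (simp add: algebra_simps)
  then show ?thesis using False by simp
qed

lemma F_signs_side:
  assumes "n + 2 < a + b"
  shows "F_signs k (a, b) (side n) = replicate k (edge_sign Minus (lv n + lv (Suc n) + (int b - int a)))"
  unfolding side_value[OF assms] side_def by (simp add: F_signs_edges del: F_signs.simps)

lemma G_signs_side:
  assumes "n + 2 < a + b"
  shows "G_signs k (a, b) (side n) = replicate k (edge_sign Plus (lv n + lv (Suc n) + (int b - int a)))"
proof (cases "lv n + (int b - int a) > 0")
  case True
  note bd = square_bounds[of n]
  let ?x = "int b * (2 * row n + 1) - int a * (2 * (col n + 1))"
  have "?x = 0 \<longleftrightarrow> int b = 2 * (col n + 1) \<and> int a = 2 * row n + 1"
    using coprime_proportional[of "int b" "int a" "2 * (col n + 1)" "2 * row n + 1"] coprime_int(1) bd assms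
    by (auto simp: coprime_commute)
  then show ?thesis using True unfolding G_signs_def side_value[OF assms]
    by (auto simp: side_def central_edge_iff F_signs_edges edge_sign_def)
next
  case False
  note bd = square_bounds[of n]
  let ?x = "int b * (2 * (row n + 1)) - int a * (2 * col n + 1)"
  have "?x = 0 \<longleftrightarrow> int b = 2 * col n + 1 \<and> int a = 2 * (row n + 1)"
    using coprime_proportional[OF coprime_int(1), of "2 * (row n + 1)" "2 * col n + 1"] bd assms
    by auto
  then show ?thesis using False unfolding G_signs_def side_value[OF assms]
    by (auto simp: side_def central_edge_iff F_signs_edges edge_sign_def)
qed

lemma F_signs_triangles:
  assumes "n + 1 < a + b"
  shows "F_signs k (a, b) (lower n) = [if lv n \<ge> 0 then Minus else Plus]"
    "F_signs k (a, b) (upper n) = [if lv n + (int b - int a) > 0 then Minus else Plus]"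
    "G_signs k (a, b) (lower n) = [if lv n \<ge> 0 then Minus else Plus]"
    "G_signs k (a, b) (upper n) = [if lv n + (int b - int a) > 0 then Minus else Plus]"
proof -
  have "F_signs k (a, b) (lower n) = [triangle_sign (a, b) (lower n)]"
    "F_signs k (a, b) (upper n) = [triangle_sign (a, b) (upper n)]"
    by (simp_all only: lower_triangle_def upper_triangle_def F_signs.simps)
  then show F: "F_signs k (a, b) (lower n) = [if lv n \<ge> 0 then Minus else Plus]"
    "F_signs k (a, b) (upper n) = [if lv n + (int b - int a) > 0 then Minus else Plus]"
    by (simp_all only: triangle_sign_lower[OF assms] triangle_sign_upper[OF assms])
  have "\<not> central_edge (a, b) (lower n)" "\<not> central_edge (a, b) (upper n)"
    by (simp_all add: central_edge_def lower_triangle_def upper_triangle_def)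
  then show "G_signs k (a, b) (lower n) = [if lv n \<ge> 0 then Minus else Plus]"
    "G_signs k (a, b) (upper n) = [if lv n + (int b - int a) > 0 then Minus else Plus]"
    by (simp_all only: G_signs_def if_False F)
qed

lemma F_signs_diag:
  "F_signs k (a, b) (diag n) = replicate k (edge_sign Minus (2 * lv n + (int b - int a)))"
proof -
  have "2 * lv n + (int b - int a) = int b * (2 * row n + 1) - int a * (2 * col n + 1)"
    by (simp add: level_square algebra_simps)
  then show ?thesis by (simp only: F_signs_edges)
qed

lemma F_signs_cells:
  "m + 1 < a + b \<Longrightarrow> concat (map (F_signs k (a, b)) (cells m)) = level_word Minus k (int b - int a) lv m"
proof (induction m)
  case 0
  then show ?case
    by (simp only: cells.simps level_word.simps square_word_def list.map concat.simps append.simps append_Nil2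
        F_signs_triangles[OF 0] F_signs_diag)
next
  case (Suc m)
  have m: "m + 2 < a + b" "m + 1 < a + b" using Suc.prems by auto
  show ?case
    by (simp only: cells.simps level_word.simps square_word_def side_word_def list.map concat.simps
        map_append concat_append append.simps append_Nil2 Suc.IH[OF m(2)]
        F_signs_triangles[OF Suc.prems] F_signs_side[OF m(1)] F_signs_diag)
qed

lemma G_signs_cells:
  "m + 1 < a + b \<Longrightarrow> concat (map (G_signs k (a, b)) (cells m)) = level_word Plus k (int b - int a) lv m"
proof (induction m)
  case 0
  then show ?case
    by (simp only: cells.simps level_word.simps square_word_def list.map concat.simps append.simps append_Nil2
        F_signs_triangles[OF 0] G_signs_diag[OF 0])
next
  case (Suc m)
  have m: "m + 2 < a + b" "m + 1 < a + b" using Suc.prems by auto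
  show ?case
    by (simp only: cells.simps level_word.simps square_word_def side_word_def list.map concat.simps
        map_append concat_append append.simps append_Nil2 Suc.IH[OF m(2)]
        F_signs_triangles[OF Suc.prems] G_signs_side[OF m(1)] G_signs_diag[OF Suc.prems])
qed

lemma F_plus_eq: "F_plus k (a, b) = cfrac_value (block_lengths (fraction_word Minus k (int a) (int b)))"
  and G_plus_eq: "G_plus k (a, b) = cfrac_value (block_lengths (fraction_word Plus k (int a) (int b)))"
proof -
  have m: "a + b - 2 + 1 < a + b" using a_pos b_pos by linarith
  have N: "nat (int a + int b - 2) = a + b - 2" by simp
  show "F_plus k (a, b) = cfrac_value (block_lengths (fraction_word Minus k (int a) (int b)))"
    by (simp only: F_plus_def passage_eq F_signs_cells[OF m] fraction_word_def N)
  show "G_plus k (a, b) = cfrac_value (block_lengths (fraction_word Plus k (int a) (int b)))"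
    by (simp only: G_plus_def passage_eq G_signs_cells[OF m] fraction_word_def N)
qed

end

theorem theorem7p28:
  fixes k a b :: nat
  assumes "coprime a b" and "0 < a" and "a < b"
  shows "F_plus k (b, a) = real_of_int (m_mid k (a, b)) / real_of_int (v_plus k (a, b)) \<and>
    G_plus k (a, b) = real_of_int (m_mid k (a, b)) / real_of_int (v_minus k (a, b)) \<and>
    G_plus k (b, a) = real_of_int (m_mid k (a, b)) / real_of_int (u_minus k (a, b))"
proof -
  interpret ab: fraction_segment a b using assms by unfold_locales auto
  interpret ba: fraction_segment b a using assms by unfold_locales (auto simp: coprime_commute)
  show ?thesis
    using fraction_words_values[OF assms] by (simp add: ab.G_plus_eq ba.F_plus_eq ba.G_plus_eq)
qed

end
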